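(* (1) For a positive integer $t$, let $\mathscr{I}_{\leq 2t}$ be the set of all inert conjugacy classes of $\Gamma=\mathrm{PSL}(2,\mathbb{Z})$ of length at most $2t$. Then, as $t\to\infty$, $$|\mathscr{I}_{\leq 2t}|\sim \frac{2^{\lfloor t/2\rfloor}}{\lfloor t/2\rfloor+1}.$$ (2) As $t\to\infty$, the number of primitive inert classes of length at most $2t$ is asymptotic ($\sim$) to the number $|\mathscr{I}_{\leq 2t}|$ of all inert conjugacy classes of length at most $2t$.
   Context: $\Gamma=\mathrm{PSL}(2,\mathbb{Z})$, with $A:z\mapsto -1/z$ and $B:z\mapsto -1/(z+1)$. Then $\Gamma$ is the free product $\langle A\rangle * \langle B\rangle\cong\mathbb{Z}_2*\mathbb{Z}_3$. For $\gamma\in\Gamma$, $\|\gamma\|$ is the word length with respect to the generating set $\{A,B,B^{-1}\}$, and the length of a conjugacy class is $\|[\gamma]\|=\min\{\|h\|:h\in[\gamma]\}$. Let $w=\begin{pmatrix}1&0\\0&-1\end{pmatrix}\in\mathrm{PGL}(2,\mathbb{Z})$ and $\phi_w(\gamma)=w^{-1}\gamma w$, an automorphism of $\Gamma$, which acts on conjugacy classes. Let $P$ be the set of primitive hyperbolic elements of $\Gamma$ (hyperbolic: absolute trace $>2$; primitive: not a proper power in $\Gamma$), and $\langle P\rangle=\{\prod_{i=1}^n p_i^{k_i}: n\ge1, p_i\in P, k_i\in\mathbb{Z}\}$. An inert class is a $\Gamma$-conjugacy class $\{p\}$ of an element $p\in\langle P\rangle$ with $\phi_w(\{p\})=\{p\}$.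 A conjugacy class is primitive if its elements are not proper powers in $\Gamma$. For real-valued functions, $f\sim g$ means $f(t)/g(t)\to1$ as $t\to\infty$. *)

theory Defs
  imports "HOL-Analysis.Analysis" "HOL-Algebra.Coset" "HOL-Library.Landau_Symbols"
begin

type_synonym mat2 = "int ^ 2 ^ 2"

definition mk_mat2 :: "int \<Rightarrow> int \<Rightarrow> int \<Rightarrow> int \<Rightarrow> mat2" where
  "mk_mat2 a b c d = vector [vector [a, b], vector [c, d]]"

definition GL2Z :: "mat2 monoid" where
  "GL2Z = \<lparr>carrier = {M. invertible M}, mult = (**), one = mat 1\<rparr>"

definition SL2Z :: "mat2 monoid" where
  "SL2Z = \<lparr>carrier = {M. det M = 1}, mult = (**), one = mat 1\<rparr>"

definition pm_one :: "mat2 set" where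
  "pm_one = {mat 1, - mat 1}"

(* Elements of both quotients are the two-element sets {M, -M}, so the carrier of PSL2Z
   is literally a subset of the carrier of PGL2Z. *)

definition PGL2Z :: "mat2 set monoid" where
  "PGL2Z = GL2Z Mod pm_one"

definition PSL2Z :: "mat2 set monoid" where
  "PSL2Z = SL2Z Mod pm_one"

definition proj_class :: "mat2 \<Rightarrow> mat2 set" where
  "proj_class M = pm_one #>\<^bsub>GL2Z\<^esub> M"

(* The Moebius maps z \<mapsto> -1/z and z \<mapsto> -1/(z+1). *)

definition gen_A :: "mat2 set" where
  "gen_A = proj_class (mk_mat2 0 (-1) 1 0)"

definition gen_B :: "mat2 set" where
  "gen_B = proj_class (mk_mat2 0 (-1) 1 1)"

definition list_prod :: "('a, 'b) monoid_scheme \<Rightarrow> 'a list \<Rightarrow> 'a" where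
  "list_prod G xs = foldr (\<lambda>x y. x \<otimes>\<^bsub>G\<^esub> y) xs \<one>\<^bsub>G\<^esub>"

definition word_length :: "mat2 set \<Rightarrow> nat" where
  "word_length g = (LEAST n. \<exists>xs. set xs \<subseteq> {gen_A, gen_B, inv\<^bsub>PSL2Z\<^esub> gen_B} \<and>
     length xs = n \<and> list_prod PSL2Z xs = g)"

definition conj_class :: "('a, 'b) monoid_scheme \<Rightarrow> 'a \<Rightarrow> 'a set" where
  "conj_class G g = {inv\<^bsub>G\<^esub> h \<otimes>\<^bsub>G\<^esub> g \<otimes>\<^bsub>G\<^esub> h | h. h \<in> carrier G}"

(* Inf on nat is the minimum of a nonempty set. *)
definition class_length :: "mat2 set set \<Rightarrow> nat" where
  "class_length C = Inf (word_length ` C)"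

definition w_PGL :: "mat2 set" where
  "w_PGL = proj_class (mk_mat2 1 0 0 (-1))"

definition phi_w :: "mat2 set \<Rightarrow> mat2 set" where
  "phi_w g = inv\<^bsub>PGL2Z\<^esub> w_PGL \<otimes>\<^bsub>PGL2Z\<^esub> g \<otimes>\<^bsub>PGL2Z\<^esub> w_PGL"

(* The absolute trace is the same for M and -M, so any representative will do. *)
definition hyperbolic :: "mat2 set \<Rightarrow> bool" where
  "hyperbolic g \<longleftrightarrow> g \<in> carrier PSL2Z \<and> (\<exists>M\<in>g. \<bar>trace M\<bar> > 2)"

(* Read literally, torsion elements are proper powers (A = A^3, B = B^4, 1 = 1^2). *)
definition proper_power :: "('a, 'b) monoid_scheme \<Rightarrow> 'a \<Rightarrow> bool" where
  "proper_power G g \<longleftrightarrow> (\<exists>h\<in>carrier G. \<exists>k::int. \<bar>k\<bar> \<ge> 2 \<and> g = h [^]\<^bsub>G\<^esub> k)"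

definition prim_hyp :: "mat2 set set" where
  "prim_hyp = {g. hyperbolic g \<and> \<not> proper_power PSL2Z g}"

definition prim_hyp_products :: "mat2 set set" where
  "prim_hyp_products = {list_prod PSL2Z (map (\<lambda>(p, k). p [^]\<^bsub>PSL2Z\<^esub> k) xs) | xs :: (mat2 set \<times> int) list.
     xs \<noteq> [] \<and> fst ` set xs \<subseteq> prim_hyp}"

definition inert_classes :: "mat2 set set set" where
  "inert_classes = {conj_class PSL2Z p | p. p \<in> prim_hyp_products \<and>
     phi_w ` conj_class PSL2Z p = conj_class PSL2Z p}"

definition inert_upto :: "nat \<Rightarrow> mat2 set set set" where
  "inert_upto n = {C \<in> inert_classes. class_length C \<le> n}"

definition primitive_class :: "mat2 set set \<Rightarrow> bool" where
  "primitive_class C \<longleftrightarrow> (\<forall>g\<in>C. \<not> proper_power PSL2Z g)"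

end

theory Submission
  imports Defs "HOL-Real_Asymp.Real_Asymp"
begin

text \<open>Apart from the classes of \<open>1\<close>, \<open>A\<close>, \<open>B\<close> and \<open>B\<inverse>\<close>, the conjugacy classes of the modular group
  correspond to the cyclic words \<open>AB\<^sup>\<plusminus>AB\<^sup>\<plusminus>\<dots>AB\<^sup>\<plusminus>\<close>, that is, to binary words \<open>e\<close> up to rotation; the length
  of the class is \<open>2|e|\<close>, and the class is primitive iff \<open>e\<close> is not periodic. Up to conjugation \<open>\<phi>\<^sub>w\<close> fixes
  \<open>A\<close> and inverts \<open>B\<close>, so inert classes come from self-complementary words, and such a word is a power
  \<open>(u u')\<^sup>q\<close> with \<open>u'\<close> the complement of \<open>u\<close>. The nonperiodic ones (\<open>q = 1\<close>) dominate: there are about \<open>2\<^sup>s\<close> of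
  length \<open>2s\<close>, in orbits of size \<open>2s\<close>, and \<open>\<Sum>\<^bsub>s\<le>S\<^esub> 2\<^sup>s/(2s) \<sim> 2\<^sup>S/(S+1)\<close>. Their classes consist of primitive
  hyperbolic elements, so the condition of lying in \<open>\<langle>P\<rangle>\<close> is harmless.\<close>

section \<open>Self-complementary words\<close>

text \<open>Membership in <P> is never characterized. From below, the representative
  \<open>ev e\<close> of a class given by a primitive self-complementary word already lies in P;
  from above, the condition is weakened to membership in the group. The primitive inert classes and
  all inert classes are thus enclosed between the same two families, which differ only by the
  classes of periodic words and four torsion classes, so one squeeze gives both claims. A word of
  length 2s gives a class of length 4s, which is at most 2t iff s is at most floor(t/2); this is
  where the exponent comes from. The real obstacle is that conjugate words must be shown to be
  rotations of each other. The free product structure is not taken for granted: up to sign, AB and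
  AB^-1 are the two elementary matrices with nonnegative entries, so words become nonnegative
  matrices, and the uniqueness facts are read off from the sizes and signs of the entries. Existence
  of word representatives is the Euclidean algorithm.\<close>

definition self_complementary :: "bool list \<Rightarrow> bool" where
  "self_complementary e \<longleftrightarrow> (\<exists>j. rotate j e = map Not e)"

definition primitive_word :: "'a list \<Rightarrow> bool" where
  "primitive_word e \<longleftrightarrow> (\<forall>j. 0 < j \<and> j < length e \<longrightarrow> rotate j e \<noteq> e)"

section \<open>Rotations, powers and periods of words\<close>

lemma map_Not_neq: "e \<noteq> [] \<Longrightarrow> map Not e \<noteq> e"
  by (cases e) auto

lemma rotate_eq_drop_take:
  assumes "d \<le> length e" shows "rotate d e = drop d e @ take d e"
proof -
  have "length (take d e) = d" using assms by simp
  then show ?thesis using rotate_append[of "take d e" "drop d e"] by (simp only: append_take_drop_id)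
qed

text \<open>Conjugacy in a free monoid: while \<open>h\<close> is at least as long as
  \<open>f\<close>, a copy of \<open>f\<close> can be stripped from its front; once \<open>h\<close>
  is shorter, \<open>f = h @ r\<close> and \<open>e = r @ h\<close>.\<close>

lemma append_eq_append_imp_rotate:
  assumes "f @ h = h @ e" "f \<noteq> []"
  shows "\<exists>j. f = rotate j e"
  using assms
proof (induction "length h" arbitrary: h rule: less_induct)
  case less
  show ?case
  proof (cases "length f \<le> length h")
    case True
    then obtain h' where h: "h = f @ h'"
      using less.prems(1) by (metis append_eq_append_conv_if append_take_drop_id)
    have "f @ h' = h' @ e" using less.prems(1) unfolding h by simp
    moreover have "length h' < length h" using less.prems(2) h by simp
    ultimately show ?thesis using less.hyps less.prems(2) by blast
  next
    case False
    then obtain r where r: "f = h @ r"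
      using less.prems(1) by (metis append_eq_append_conv_if append_take_drop_id nat_le_linear)
    then have "e = r @ h" using less.prems(1) by simp
    then show ?thesis using r rotate_append by metis
  qed
qed

lemma length_concat_replicate: "length (concat (replicate n f)) = n * length f"
  by (induction n) auto

lemma append_concat_replicate_comm:
  "f @ concat (replicate n f) = concat (replicate n f) @ f"
  by (induction n) auto

lemma rotate_concat_replicate:
  "rotate (length f) (concat (replicate n f)) = concat (replicate n f)"
proof (cases n)
  case (Suc m)
  then show ?thesis
    by (simp add: rotate_append flip: append_concat_replicate_comm)
qed simp

text \<open>A nonempty \<open>r\<close> is long enough to start with \<open>v\<close>, and removing
  this prefix preserves the commutation.\<close>

lemma append_comm_imp_concat_replicate:
  assumes "v @ r = r @ v" "length r = m * length v"
  shows "r = concat (replicate m v)"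
  using assms
proof (induction m arbitrary: r)
  case (Suc m)
  have "length v \<le> length r" using Suc.prems(2) by simp
  then obtain r' where r: "r = v @ r'"
    using Suc.prems(1) by (metis append_eq_append_conv_if append_take_drop_id)
  have "v @ r' = r' @ v" using Suc.prems(1) unfolding r by simp
  moreover have "length r' = m * length v" using Suc.prems(2) r by simp
  ultimately show ?case using Suc.IH r by simp
qed simp

text \<open>Being fixed by the rotation by \<open>d\<close> means that the prefix of length
  \<open>d\<close> commutes with the rest.\<close>

lemma rotate_fixed_imp_concat_replicate:
  assumes "rotate d e = e" "d * q = length e" "q > 0"
  shows "e = concat (replicate q (take d e))"
proof -
  obtain m where q: "q = Suc m" using assms(3) by (cases q) auto
  have d: "d \<le> length e" using assms(2) q by simp
  show ?thesis
  proof (cases "d = 0")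
    case True then show ?thesis using assms(2) by auto
  next
    case False
    have "rotate d e = drop d e @ take d e" using d by (rule rotate_eq_drop_take)
    then have c: "take d e @ drop d e = drop d e @ take d e" using assms(1) by simp
    have "drop d e = concat (replicate m (take d e))"
      by (rule append_comm_imp_concat_replicate[OF c]) (use d in \<open>simp add: q algebra_simps flip: assms(2)\<close>)
    then show ?thesis unfolding q by (metis append_take_drop_id concat.simps(2) replicate_Suc)
  qed
qed

lemma rotate_mult_fixed: "rotate d e = e \<Longrightarrow> rotate (m * d) e = e"
  by (induction m) (simp_all flip: rotate_rotate)

text \<open>\<open>j\<close> is the least shift that yields the complement. Two such shifts restore
  the word, and minimality leaves room for no period between 0 and \<open>2 * j\<close>.\<close>

lemma self_complementary_half_period:
  assumes "self_complementary e" "e \<noteq> []"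
  obtains j where "j > 0" "rotate j e = map Not e" "\<And>r. rotate r e = e \<Longrightarrow> 2 * j dvd r"
proof -
  define j where "j = (LEAST j. rotate j e = map Not e)"
  have j: "rotate j e = map Not e"
    unfolding j_def using assms(1) unfolding self_complementary_def by (rule LeastI_ex)
  have min: "j \<le> i" if "rotate i e = map Not e" for i
    unfolding j_def using that by (rule Least_le)
  have pos: "j > 0" using j map_Not_neq[OF assms(2)] by (cases "j = 0") auto
  have jj: "rotate (2 * j) e = e"
  proof -
    have "rotate (j + j) e = rotate j (map Not e)" using j by (simp flip: rotate_rotate)
    also have "\<dots> = e" using j by (simp add: rotate_map o_def)
    finally show ?thesis by (simp add: mult_2)
  qed
  have "2 * j dvd r" if r: "rotate r e = e" for r
  proof (rule ccontr)
    assume nd: "\<not> 2 * j dvd r"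
    define k where "k = r mod (2 * j)"
    have k: "0 < k" "k < 2 * j" using nd pos by (auto simp: k_def mod_greater_zero_iff_not_dvd)
    have "r = k + (r div (2 * j)) * (2 * j)" using div_mult_mod_eq[of r "2 * j"] by (simp add: k_def del: div_mult_mod_eq)
    then have "rotate r e = rotate k (rotate ((r div (2 * j)) * (2 * j)) e)"
      by (metis rotate_rotate)
    then have rk: "rotate k e = e" using r rotate_mult_fixed[OF jj] by simp
    \<comment> \<open>A period \<open>k\<close> below \<open>j\<close> gives the complementing shift
      \<open>j - k\<close>, one above \<open>j\<close> gives \<open>k - j\<close>, both smaller than
      \<open>j\<close>; \<open>k = j\<close> would make \<open>e\<close> its own complement.\<close>
    consider "k < j" | "k = j" | "j < k" by linarith
    then show False
    proof cases
      case 1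
      have "rotate (j - k) (rotate k e) = rotate j e" using 1 by (simp add: rotate_rotate)
      then have "rotate (j - k) e = map Not e" using rk j by simp
      then show False using min[of "j - k"] 1 k by simp
    next
      case 2 then show False using rk j map_Not_neq[OF assms(2)] by simp
    next
      case 3
      have "rotate (k - j) (rotate j e) = e" using 3 rk by (simp add: rotate_rotate)
      then have "map Not (rotate (k - j) e) = e" by (simp add: j rotate_map)
      then have "map Not (map Not (rotate (k - j) e)) = map Not e" by simp
      then have "rotate (k - j) e = map Not e" by (simp add: o_def)
      then show False using min[of "k - j"] 3 k by simp
    qed
  qed
  then show thesis using that pos j by blast
qed

text \<open>\<open>length e\<close> is a period, hence a multiple of the least period
  \<open>2 * j\<close>; the second half of that period is the complement of the first half
  \<open>u\<close>. The word is primitive exactly when a single period fills it.\<close>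

lemma self_complementary_decomposition:
  assumes "self_complementary e" "e \<noteq> []"
  obtains q u where "e = concat (replicate q (u @ map Not u))" "u \<noteq> []" "q > 0"
    "primitive_word e \<longleftrightarrow> q = 1"
proof -
  obtain j where j: "j > 0" "rotate j e = map Not e" "\<And>r. rotate r e = e \<Longrightarrow> 2 * j dvd r"
    using self_complementary_half_period[OF assms] by blast
  have "2 * j dvd length e" by (rule j(3)) (simp add: rotate_id)
  then obtain q where q: "length e = 2 * j * q" by (elim dvdE)
  have q0: "q > 0" using assms(2) q by (cases q) auto
  have le: "2 * j \<le> length e" using q q0 by simp
  define u where "u = take j e"
  have lu: "length u = j" using le by (simp add: u_def)
  have "rotate j e = drop j e @ take j e" using le by (intro rotate_eq_drop_take) simp
  then have "take j (map Not e) = take j (drop j e @ take j e)" using j(2) by simp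
  then have "map Not u = take j (drop j e)" using le by (simp add: u_def take_map)
  then have v: "take (2 * j) e = u @ map Not u" unfolding u_def
    by (metis mult_2 take_add)
  have "rotate j (rotate j e) = e" using j(2) by (simp add: rotate_map o_def)
  then have per: "rotate (2 * j) e = e" by (simp add: rotate_rotate mult_2)
  have e: "e = concat (replicate q (u @ map Not u))"
    using rotate_fixed_imp_concat_replicate[OF per q[symmetric] q0] v by simp
  have "primitive_word e \<longleftrightarrow> q = 1"
  proof
    assume "primitive_word e"
    then have "\<not> 2 * j < length e" using per j(1) by (auto simp: primitive_word_def)
    then show "q = 1" using q q0 j(1) by (cases q) auto
  next
    assume "q = 1"
    then show "primitive_word e"
      unfolding primitive_word_def using j(3) q by (metis dvd_imp_le mult.right_neutral not_le)
  qed
  then show thesis using that[OF e] lu j(1) q0 by fastforce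
qed

section \<open>Counting self-complementary words\<close>

definition primitive_sc_words :: "nat \<Rightarrow> bool list set" where
  "primitive_sc_words n = {e. length e = n \<and> self_complementary e \<and> primitive_word e}"

text \<open>All lengths up to \<open>n\<close> are collected because these words enter only as an
  error term, for which monotonicity in \<open>n\<close> is convenient.\<close>

definition nonprimitive_sc_words :: "nat \<Rightarrow> bool list set" where
  "nonprimitive_sc_words n =
     {e. e \<noteq> [] \<and> length e \<le> n \<and> self_complementary e \<and> \<not> primitive_word e}"

lemma finite_primitive_sc_words: "finite (primitive_sc_words n)"
  by (rule finite_subset[OF _ finite_lists_length_eq[of UNIV n]])
    (auto simp: primitive_sc_words_def)

text \<open>A nonprimitive word repeats its period at least twice, so \<open>u\<close> has at most a
  quarter of its length. This leaves about \<open>2 ^ (n div 4)\<close> words up to a linear factor,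
  against \<open>2 ^ (n div 2)\<close> choices of a first half.\<close>

lemma nonprimitive_sc_words_subset:
  "nonprimitive_sc_words n \<subseteq>
     (\<lambda>(q, u). concat (replicate q (u @ map Not u))) ` ({..n} \<times> {u. set u \<subseteq> UNIV \<and> length u \<le> n div 4})"
proof
  fix e assume e: "e \<in> nonprimitive_sc_words n"
  then have "self_complementary e" "e \<noteq> []" by (auto simp: nonprimitive_sc_words_def)
  then obtain q u where d: "e = concat (replicate q (u @ map Not u))" "u \<noteq> []" "q > 0"
    "primitive_word e \<longleftrightarrow> q = 1" by (rule self_complementary_decomposition)
  have q: "2 \<le> q" using d e by (auto simp: nonprimitive_sc_words_def)
  have "length e = q * (2 * length u)" by (simp add: d(1) length_concat_replicate)
  then have len: "q * (2 * length u) \<le> n" using e by (simp add: nonprimitive_sc_words_def)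
  have "2 * (2 * length u) \<le> q * (2 * length u)" using q by (rule mult_le_mono1)
  then have "length u \<le> n div 4" using len by linarith
  moreover have "q \<le> n"
  proof -
    have "q * 1 \<le> q * (2 * length u)" using d(2) by (intro mult_le_mono2) (cases u, auto)
    then show ?thesis using len by linarith
  qed
  ultimately show "e \<in> (\<lambda>(q, u). concat (replicate q (u @ map Not u))) `
      ({..n} \<times> {u. set u \<subseteq> UNIV \<and> length u \<le> n div 4})"
    using d(1) by (auto intro!: image_eqI[of _ _ "(q, u)"])
qed

lemma finite_nonprimitive_sc_words: "finite (nonprimitive_sc_words n)"
  by (rule finite_subset[OF nonprimitive_sc_words_subset])
    (intro finite_imageI finite_cartesian_product finite_lists_length_le; simp)

lemma card_nonprimitive_sc_words: "card (nonprimitive_sc_words n) \<le> (n + 1) * 2 ^ (n div 4 + 1)"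
proof -
  let ?U = "{u::bool list. set u \<subseteq> UNIV \<and> length u \<le> n div 4}"
  have fin: "finite ?U" by (rule finite_lists_length_le) simp
  have "card (nonprimitive_sc_words n) \<le> card ({..n} \<times> ?U)"
    using fin by (intro surj_card_le[OF _ nonprimitive_sc_words_subset]) auto
  also have "\<dots> = (n + 1) * (\<Sum>i\<le>n div 4. 2 ^ i)"
    using card_lists_length_le[of "UNIV::bool set" "n div 4"] by (simp add: card_cartesian_product)
  also have "(\<Sum>i\<le>n div 4. 2 ^ i) = (2::nat) ^ (n div 4 + 1) - 1"
    using sum_power2[of "n div 4 + 1"] by (simp add: atLeast0LessThan lessThan_Suc_atMost)
  finally show ?thesis
    by (meson diff_le_self mult_le_mono2 order.trans)
qed

lemma primitive_sc_words_even:
  assumes "e \<in> primitive_sc_words n" "n > 0"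
  obtains u where "e = u @ map Not u" "n = 2 * length u"
proof -
  have "self_complementary e" "e \<noteq> []" using assms by (auto simp: primitive_sc_words_def)
  then obtain q u where d: "e = concat (replicate q (u @ map Not u))" "u \<noteq> []" "q > 0"
    "primitive_word e \<longleftrightarrow> q = 1" by (rule self_complementary_decomposition)
  then have "e = u @ map Not u" using assms(1) by (simp add: primitive_sc_words_def)
  moreover have "n = 2 * length u" using assms(1) calculation by (simp add: primitive_sc_words_def)
  ultimately show thesis by (rule that)
qed

lemma card_primitive_sc_words_le:
  assumes "s > 0" shows "card (primitive_sc_words (2 * s)) \<le> 2 ^ s"
proof -
  let ?U = "{u::bool list. set u \<subseteq> UNIV \<and> length u = s}"
  have "primitive_sc_words (2 * s) \<subseteq> (\<lambda>u. u @ map Not u) ` ?U"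
    using assms by (auto elim!: primitive_sc_words_even)
  then have "card (primitive_sc_words (2 * s)) \<le> card ?U"
    using finite_lists_length_eq[of "UNIV::bool set" s] by (intro surj_card_le) auto
  then show ?thesis using card_lists_length_eq[of "UNIV::bool set" s] by simp
qed

text \<open>Every first half \<open>u\<close> completes to the self-complementary word
  \<open>u @ map Not u\<close>, which falls into one of the two sets.\<close>

lemma card_primitive_sc_words_ge:
  assumes "s > 0"
  shows "2 ^ s \<le> card (primitive_sc_words (2 * s)) + card (nonprimitive_sc_words (2 * s))"
proof -
  let ?U = "{u::bool list. set u \<subseteq> UNIV \<and> length u = s}"
  have inj: "inj_on (\<lambda>u. u @ map Not u) ?U" by (auto simp: inj_on_def)
  have "(\<lambda>u. u @ map Not u) ` ?U \<subseteq> primitive_sc_words (2 * s) \<union> nonprimitive_sc_words (2 * s)"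
  proof
    fix e assume "e \<in> (\<lambda>u. u @ map Not u) ` ?U"
    then obtain u where u: "e = u @ map Not u" "length u = s" by auto
    have "rotate s e = map Not e" using u rotate_append[of u "map Not u"] by (simp add: o_def)
    then have "self_complementary e" by (auto simp: self_complementary_def)
    then show "e \<in> primitive_sc_words (2 * s) \<union> nonprimitive_sc_words (2 * s)"
      using u assms by (auto simp: primitive_sc_words_def nonprimitive_sc_words_def)
  qed
  then have "card ((\<lambda>u. u @ map Not u) ` ?U) \<le> card (primitive_sc_words (2 * s) \<union> nonprimitive_sc_words (2 * s))"
    by (intro card_mono) (auto simp: finite_primitive_sc_words finite_nonprimitive_sc_words)
  also have "\<dots> \<le> card (primitive_sc_words (2 * s)) + card (nonprimitive_sc_words (2 * s))"
    by (rule card_Un_le)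
  finally show ?thesis
    using card_lists_length_eq[of "UNIV::bool set" s] card_image[OF inj] by simp
qed

text \<open>Rotation keeps the set of letters, which is therefore closed under \<open>Not\<close>.
  Later this makes both off-diagonal entries of the associated matrix positive.\<close>

lemma self_complementary_letters:
  assumes "self_complementary e" "e \<noteq> []" shows "x \<in> set e"
proof -
  obtain j where "rotate j e = map Not e" using assms(1) by (auto simp: self_complementary_def)
  then have eq: "set e = Not ` set e" by (metis set_map set_rotate)
  obtain y where "y \<in> set e" using assms(2) by (cases e) auto
  then have "y \<in> set e" "(\<not> y) \<in> set e" using eq by auto
  then show ?thesis by (cases "x = y") auto
qed

lemma card_rotations:
  assumes "primitive_word e" shows "card ((\<lambda>j. rotate j e) ` {..<length e}) = length e"
proof -
  have "rotate i e \<noteq> rotate j e" if "i < j" "j < length e" for i j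
  proof
    assume eq: "rotate i e = rotate j e"
    \<comment> \<open>Rotating both sides by \<open>length e - i\<close> undoes the rotation by
      \<open>i\<close> and exposes \<open>j - i\<close> as a period.\<close>
    have "length e - i + j = j - i + length e" using that by simp
    then have "rotate (length e - i) (rotate j e) = rotate (j - i) (rotate (length e) e)"
      unfolding rotate_rotate by (rule arg_cong)
    also have "rotate (length e) e = e" by (simp add: rotate_id)
    also have "rotate (length e - i) (rotate j e) = e" unfolding eq[symmetric]
      using that by (simp add: rotate_rotate rotate_id)
    finally have "rotate (j - i) e = e" ..
    then show False using assms that by (auto simp: primitive_word_def)
  qed
  then have "inj_on (\<lambda>j. rotate j e) {..<length e}"
    by (intro linorder_inj_onI) auto
  then show ?thesis by (simp add: card_image)
qed

lemma primitive_sc_words_rotate: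
  assumes "e \<in> primitive_sc_words n" shows "rotate i e \<in> primitive_sc_words n"
proof -
  have inj: "e = f" if "rotate i e = rotate i f" "length e = length f" for e f :: "bool list"
  proof -
    \<comment> \<open>The rotation by \<open>i\<close> is undone by completing it to
      \<open>i\<close> full turns.\<close>
    have "rotate (i * length e - i) (rotate i e) = rotate (i * length f - i) (rotate i f)"
      using that by simp
    then show ?thesis using that(2)
      by (cases "length e") (simp_all add: rotate_rotate rotate_id)
  qed
  obtain j where j: "rotate j e = map Not e"
    using assms by (auto simp: primitive_sc_words_def self_complementary_def)
  have "rotate j (rotate i e) = rotate i (rotate j e)" by (simp add: rotate_rotate add.commute)
  then have "self_complementary (rotate i e)"
    unfolding self_complementary_def j by (auto simp: rotate_map)
  moreover have "rotate k (rotate i e) \<noteq> rotate i e" if "0 < k" "k < length e" for k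
  proof
    assume "rotate k (rotate i e) = rotate i e"
    then have "rotate i (rotate k e) = rotate i e" by (simp add: rotate_rotate add.commute)
    then have "rotate k e = e" by (rule inj) simp
    then show False using assms that by (auto simp: primitive_sc_words_def primitive_word_def)
  qed
  ultimately show ?thesis using assms by (simp add: primitive_sc_words_def primitive_word_def)
qed

section \<open>Conjugacy in the free product of groups of orders 2 and 3\<close>

text \<open>Free of inverses, so that the equation can be carried over to the free monoid of
  words.\<close>

definition conjugate :: "('a, 'b) monoid_scheme \<Rightarrow> 'a \<Rightarrow> 'a \<Rightarrow> bool" where
  "conjugate G x y \<longleftrightarrow> (\<exists>h\<in>carrier G. x \<otimes>\<^bsub>G\<^esub> h = h \<otimes>\<^bsub>G\<^esub> y)"

section \<open>Conjugacy and products of lists in an arbitrary group\<close>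

context group
begin

lemma conjugate_refl: "x \<in> carrier G \<Longrightarrow> conjugate G x x"
  unfolding conjugate_def by (rule bexI[of _ \<one>]) auto

lemma conjugateI:
  assumes "x \<in> carrier G" "h \<in> carrier G"
  shows "conjugate G (x \<otimes> h) (h \<otimes> x)" "conjugate G (h \<otimes> x) (x \<otimes> h)"
  unfolding conjugate_def using assms
  by (intro bexI[of _ x] bexI[of _ h]; simp add: m_assoc)+

lemma conjugate_trans:
  assumes "conjugate G x y" "conjugate G y z" "x \<in> carrier G" "y \<in> carrier G" "z \<in> carrier G"
  shows "conjugate G x z"
proof -
  obtain h k where hk: "h \<in> carrier G" "k \<in> carrier G" "x \<otimes> h = h \<otimes> y" "y \<otimes> k = k \<otimes> z"
    using assms unfolding conjugate_def by blast
  have "x \<otimes> (h \<otimes> k) = (x \<otimes> h) \<otimes> k" using hk(1,2) assms by (simp add: m_assoc)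
  also have "\<dots> = h \<otimes> (y \<otimes> k)" using hk assms by (simp add: m_assoc)
  also have "\<dots> = (h \<otimes> k) \<otimes> z" using hk assms by (simp add: m_assoc)
  finally show ?thesis unfolding conjugate_def using hk by blast
qed

lemma conjugate_sym:
  assumes "conjugate G x y" "x \<in> carrier G" "y \<in> carrier G"
  shows "conjugate G y x"
proof -
  obtain h where h: "h \<in> carrier G" "x \<otimes> h = h \<otimes> y"
    using assms unfolding conjugate_def by blast
  have "inv h \<otimes> (x \<otimes> h) \<otimes> inv h = inv h \<otimes> (h \<otimes> y) \<otimes> inv h" using h by simp
  then have "inv h \<otimes> x = y \<otimes> inv h" using h assms
    by (metis inv_closed inv_solve_left' inv_solve_right m_assoc m_closed)
  then show ?thesis unfolding conjugate_def using h(1) by (metis inv_closed)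
qed

lemma conjugate_nat_pow:
  assumes "conjugate G x y" "x \<in> carrier G" "y \<in> carrier G"
  shows "conjugate G (x [^] (n::nat)) (y [^] n)"
proof -
  obtain h where h: "h \<in> carrier G" "x \<otimes> h = h \<otimes> y"
    using assms unfolding conjugate_def by blast
  have "x [^] n \<otimes> h = h \<otimes> y [^] n"
  proof (induction n)
    case (Suc n)
    have "x [^] Suc n \<otimes> h = x [^] n \<otimes> (h \<otimes> y)" using h assms by (simp add: m_assoc)
    also have "\<dots> = (x [^] n \<otimes> h) \<otimes> y" using h(1) assms by (simp add: m_assoc)
    also have "\<dots> = h \<otimes> y [^] Suc n" using h(1) assms by (simp add: Suc m_assoc)
    finally show ?case .
  qed (use h in auto)
  then show ?thesis unfolding conjugate_def using h by blast
qed

lemma conjugate_one_iff: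
  assumes "x \<in> carrier G" shows "conjugate G x \<one> \<longleftrightarrow> x = \<one>"
  using assms unfolding conjugate_def by (auto intro: conjugate_refl)

lemma conj_class_eq:
  assumes "x \<in> carrier G"
  shows "conj_class G x = {y \<in> carrier G. conjugate G x y}"
proof -
  have inv_conj: "inv h \<otimes> x \<otimes> h = y \<longleftrightarrow> x \<otimes> h = h \<otimes> y" if "h \<in> carrier G" "y \<in> carrier G" for h y
    using assms that by (metis inv_closed inv_solve_left m_assoc m_closed)
  show ?thesis
  proof (intro Set.set_eqI iffI)
    fix y assume "y \<in> conj_class G x"
    then obtain h where "h \<in> carrier G" "y = inv h \<otimes> x \<otimes> h" unfolding conj_class_def by blast
    then show "y \<in> {y \<in> carrier G. conjugate G x y}"
      using assms inv_conj[of h y] unfolding conjugate_def by auto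
  next
    fix y assume "y \<in> {y \<in> carrier G. conjugate G x y}"
    then obtain h where "h \<in> carrier G" "y \<in> carrier G" "x \<otimes> h = h \<otimes> y"
      unfolding conjugate_def by blast
    then show "y \<in> conj_class G x"
      using inv_conj[of h y] unfolding conj_class_def by blast
  qed
qed

lemma conj_class_eq_iff:
  assumes "x \<in> carrier G" "y \<in> carrier G"
  shows "conj_class G x = conj_class G y \<longleftrightarrow> conjugate G x y"
proof
  assume "conj_class G x = conj_class G y"
  then have "y \<in> conj_class G x" using assms conjugate_refl by (simp add: conj_class_eq)
  then show "conjugate G x y" using assms by (simp add: conj_class_eq)
next
  assume xy: "conjugate G x y"
  have "conjugate G x z \<longleftrightarrow> conjugate G y z" if "z \<in> carrier G" for z
  proof
    assume "conjugate G x z"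
    with conjugate_sym[OF xy assms] show "conjugate G y z"
      by (rule conjugate_trans) (use assms that in auto)
  next
    assume "conjugate G y z"
    with xy show "conjugate G x z" by (rule conjugate_trans) (use assms that in auto)
  qed
  then show "conj_class G x = conj_class G y" using assms by (auto simp: conj_class_eq)
qed

text \<open>A negative exponent is absorbed by inverting \<open>h\<close>, so that only natural
  exponents remain.\<close>

lemma proper_power_conjugate:
  assumes "conjugate G x y" "x \<in> carrier G" "y \<in> carrier G" "proper_power G x"
  obtains h n where "h \<in> carrier G" "n \<ge> (2::nat)" "conjugate G y (h [^] n)"
proof -
  obtain h and k :: int where h: "h \<in> carrier G" "\<bar>k\<bar> \<ge> 2" "x = h [^] k"
    using assms(4) unfolding proper_power_def by blast
  define g where "g = (if k \<ge> 0 then h else inv h)"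
  have g: "g \<in> carrier G" using h(1) by (simp add: g_def)
  have "x = g [^] nat \<bar>k\<bar>"
  proof (cases "k \<ge> 0")
    case True
    then obtain n where "k = int n" by (rule nonneg_int_cases)
    then show ?thesis by (simp add: h(3) g_def int_pow_int)
  next
    case False
    then obtain n where n: "k = - int n" "n > 0" by (intro that[of "nat (- k)"]) auto
    then show ?thesis using h(1) by (simp add: h(3) g_def int_pow_neg_int nat_pow_inv)
  qed
  moreover have "nat \<bar>k\<bar> \<ge> 2" using h(2) by simp
  moreover have "conjugate G y x" using conjugate_sym[OF assms(1-3)] .
  ultimately show thesis using that[OF g, of "nat \<bar>k\<bar>"] by simp
qed

lemma list_prod_Nil [simp]: "list_prod G [] = \<one>"
  by (simp add: list_prod_def)

lemma list_prod_Cons [simp]: "list_prod G (x # xs) = x \<otimes> list_prod G xs"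
  by (simp add: list_prod_def)

lemma list_prod_closed [simp]: "set xs \<subseteq> carrier G \<Longrightarrow> list_prod G xs \<in> carrier G"
  by (induction xs) auto

lemma list_prod_append:
  "set xs \<subseteq> carrier G \<Longrightarrow> set ys \<subseteq> carrier G \<Longrightarrow>
    list_prod G (xs @ ys) = list_prod G xs \<otimes> list_prod G ys"
  by (induction xs) (auto simp: m_assoc)

end

section \<open>Words in generators satisfying the relations of orders 2 and 3\<close>

locale generators_2_3 = group +
  fixes a b
  assumes a_closed [simp]: "a \<in> carrier G" and b_closed [simp]: "b \<in> carrier G"
    and aa [simp]: "a \<otimes> a = \<one>" and bbb: "b \<otimes> (b \<otimes> b) = \<one>"
begin

text \<open>As \<open>inv b\<close> is the square of \<open>b\<close>, complementing the Boolean is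
  at once inversion and squaring.\<close>

definition letter :: "bool \<Rightarrow> 'a" where
  "letter x = (if x then b else inv b)"

definition syll :: "bool \<Rightarrow> 'a" where
  "syll x = a \<otimes> letter x"

definition ev :: "bool list \<Rightarrow> 'a" where
  "ev e = list_prod G (map syll e)"

lemma letter_closed [simp]: "letter x \<in> carrier G"
  by (simp add: letter_def)

lemma syll_closed [simp]: "syll x \<in> carrier G"
  by (simp add: syll_def)

lemma ev_closed [simp]: "ev e \<in> carrier G"
  unfolding ev_def by (rule list_prod_closed) auto

lemma ev_Nil [simp]: "ev [] = \<one>"
  by (simp add: ev_def)

lemma ev_Cons: "ev (x # e) = a \<otimes> (letter x \<otimes> ev e)"
proof -
  have "ev (x # e) = syll x \<otimes> ev e" by (simp add: ev_def)
  then show ?thesis by (simp add: syll_def m_assoc)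
qed

lemma ev_append: "ev (e @ f) = ev e \<otimes> ev f"
  unfolding ev_def map_append by (rule list_prod_append) auto

lemma ev_snoc: "ev (e @ [x]) = ev e \<otimes> (a \<otimes> letter x)"
  by (simp add: ev_append ev_Cons)

lemma ev_replicate: "ev (concat (replicate n e)) = ev e [^] n"
  by (induction n) (simp_all add: append_concat_replicate_comm, simp add: ev_append)

lemma inv_b: "inv b = b \<otimes> b"
  using bbb by (intro inv_equality) (simp_all add: m_assoc)

lemma letter_letter [simp]: "letter x \<otimes> letter x = letter (\<not> x)"
proof (cases x)
  case False
  have "inv b \<otimes> inv b = b \<otimes> (b \<otimes> (b \<otimes> b))" by (simp add: inv_b m_assoc)
  also have "\<dots> = b" using bbb by simp
  finally show ?thesis using False by (simp add: letter_def)
qed (simp add: letter_def inv_b)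

lemma letter_letter_Not [simp]: "letter x \<otimes> letter (\<not> x) = \<one>" "letter (\<not> x) \<otimes> letter x = \<one>"
  by (auto simp: letter_def)

text \<open>Cancellation inside right-nested products: together with \<open>m_assoc\<close>, these
  rules reduce words modulo the relations.\<close>

lemma assoc_simps [simp]:
  "z \<in> carrier G \<Longrightarrow> a \<otimes> (a \<otimes> z) = z"
  "z \<in> carrier G \<Longrightarrow> letter x \<otimes> (letter x \<otimes> z) = letter (\<not> x) \<otimes> z"
  "z \<in> carrier G \<Longrightarrow> letter x \<otimes> (letter (\<not> x) \<otimes> z) = z"
  "z \<in> carrier G \<Longrightarrow> letter (\<not> x) \<otimes> (letter x \<otimes> z) = z"
  by (simp_all flip: m_assoc)

lemma generator_cases:
  assumes "g \<in> {a, b, inv b}" obtains "g = a" | x where "g = letter x"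
proof -
  consider "g = a" | "g = letter True" | "g = letter False" using assms by (auto simp: letter_def)
  then show thesis using that by cases
qed

lemma generators_closed: "set xs \<subseteq> {a, b, inv b} \<Longrightarrow> set xs \<subseteq> carrier G"
  by auto

end

text \<open>The two uniqueness assumptions are the part of the normal form theorem of the free product
  of \<open>\<langle>a\<rangle>\<close> and \<open>\<langle>b\<rangle>\<close> that conjugacy needs.\<close>
locale free_product_2_3 = generators_2_3 +
  assumes generated: "\<And>g. g \<in> carrier G \<Longrightarrow> \<exists>xs. set xs \<subseteq> {a, b, inv b} \<and> list_prod G xs = g"
    and ev_inject: "ev e = ev f \<Longrightarrow> e = f"
    and letter_ev_neq: "letter x \<otimes> ev e \<noteq> ev f" "letter x \<otimes> ev e \<noteq> ev f \<otimes> a"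
begin

section \<open>Normal forms and cyclic reduction\<close>

definition pre :: "bool option \<Rightarrow> 'a" where
  "pre p = (case p of None \<Rightarrow> \<one> | Some x \<Rightarrow> letter x)"

definition suf :: "bool \<Rightarrow> 'a" where
  "suf y = (if y then a else \<one>)"

lemma pre_simps [simp]: "pre None = \<one>" "pre (Some x) = letter x"
  by (simp_all add: pre_def)

lemma suf_simps [simp]: "suf True = a" "suf False = \<one>"
  by (simp_all add: suf_def)

lemma pre_closed [simp]: "pre p \<in> carrier G"
  by (cases p) auto

lemma suf_closed [simp]: "suf y \<in> carrier G"
  by (cases y) auto

lemma letter_pre: "\<exists>q. letter x \<otimes> pre p = pre q"
proof (cases p)
  case None then show ?thesis by (intro exI[of _ "Some x"]) simp
next
  case (Some y)
  show ?thesis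
  proof (cases "x = y")
    case True
    then show ?thesis using Some by (intro exI[of _ "Some (\<not> x)"]) simp
  next
    case False
    then have "y = (\<not> x)" by auto
    then show ?thesis using Some by (intro exI[of _ None]) simp
  qed
qed

definition size_pre :: "bool option \<Rightarrow> nat" where
  "size_pre p = (case p of None \<Rightarrow> 0 | Some x \<Rightarrow> 1)"

lemma size_pre_simps [simp]: "size_pre None = 0" "size_pre (Some x) = 1"
  by (simp_all add: size_pre_def)

lemma size_pre_le: "size_pre p \<le> 1"
  by (cases p) auto

lemma letter_pre_size: "\<exists>q. letter x \<otimes> pre p = pre q \<and> size_pre q \<le> Suc (size_pre p)"
proof -
  obtain q where "letter x \<otimes> pre p = pre q" using letter_pre by blast
  then show ?thesis using size_pre_le[of q] by auto
qed

text \<open>An alternating word is an optional leading letter, then blocks of \<open>a\<close> and a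
  letter, then an optional trailing \<open>a\<close>. Prepending a generator keeps this shape and
  adds at most 1 to its length.\<close>

lemma list_prod_normal_form:
  assumes "set xs \<subseteq> {a, b, inv b}"
  shows "\<exists>p h y. list_prod G xs = pre p \<otimes> (ev h \<otimes> suf y) \<and>
           size_pre p + 2 * length h + of_bool y \<le> length xs"
  using assms
proof (induction xs)
  case Nil
  show ?case by (intro exI[of _ None] exI[of _ "[]"] exI[of _ False]) simp
next
  case (Cons g xs)
  then obtain p h y where IH: "list_prod G xs = pre p \<otimes> (ev h \<otimes> suf y)"
    "size_pre p + 2 * length h + of_bool y \<le> length xs" by auto
  have "g \<in> {a, b, inv b}" using Cons.prems by simp
  then show ?case
  proof (cases rule: generator_cases)
    case 1
    show ?thesis
    proof (cases p)
      case (Some x)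
      then show ?thesis using IH 1
        by (intro exI[of _ None] exI[of _ "x # h"] exI[of _ y]) (simp add: ev_Cons m_assoc)
    next
      case None
      show ?thesis
      proof (cases h)
        case Nil
        \<comment> \<open>Nothing but a possible trailing \<open>a\<close> is left, so the new
          \<open>a\<close> toggles it.\<close>
        then show ?thesis using IH 1 None
          by (intro exI[of _ None] exI[of _ "[]"] exI[of _ "\<not> y"]) (cases y; simp)
      next
        case (Cons x h')
        then show ?thesis using IH 1 None
          by (intro exI[of _ "Some x"] exI[of _ h'] exI[of _ y]) (simp add: ev_Cons m_assoc)
      qed
    qed
  next
    case (2 x)
    obtain q where q: "letter x \<otimes> pre p = pre q" "size_pre q \<le> Suc (size_pre p)"
      using letter_pre_size by blast
    then show ?thesis using IH 2
      by (intro exI[of _ q] exI[of _ h] exI[of _ y]) (simp flip: m_assoc)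
  qed
qed

text \<open>Moving one end of the normal form to the other is a conjugation. The two ends then join
  to a block, merge or cancel, until only blocks or a single generator remain.\<close>

lemma cyclic_reduction:
  "\<exists>z. conjugate G (pre p \<otimes> (ev h \<otimes> suf y)) z \<and>
     (z \<in> {a, b, inv b} \<or> (\<exists>f. z = ev f \<and> 2 * length f \<le> size_pre p + 2 * length h + of_bool y))"
proof (induction "length h" arbitrary: p h y rule: less_induct)
  case less
  \<comment> \<open>Losing a block saves 2, which pays for the leading letter and the trailing
    \<open>a\<close> that the new form may acquire.\<close>
  have step: ?case if c: "conjugate G (pre p \<otimes> (ev h \<otimes> suf y)) (pre q \<otimes> (ev k \<otimes> suf w))"
    and l: "length k < length h" for q k w
  proof -
    obtain z where z: "conjugate G (pre q \<otimes> (ev k \<otimes> suf w)) z"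
     "z \<in> {a, b, inv b} \<or> (\<exists>f. z = ev f \<and> 2 * length f \<le> size_pre q + 2 * length k + of_bool w)"
      using less[OF l] by blast
    have "z \<in> carrier G" using z(2) by auto
    then have "conjugate G (pre p \<otimes> (ev h \<otimes> suf y)) z" using conjugate_trans[OF c z(1)] by simp
    moreover have "size_pre q + 2 * length k + of_bool w \<le> size_pre p + 2 * length h + of_bool y"
      using l size_pre_le[of q] by (cases w) auto
    ultimately show ?thesis using z(2) by (blast intro: le_trans)
  qed
  show ?case
  proof (cases p)
    case None
    show ?thesis
    proof (cases y)
      case False
      then show ?thesis using None by (intro exI[of _ "ev h"]) (auto intro: conjugate_refl)
    next
      case True
      show ?thesis
      proof (cases h)
        case Nil
        then show ?thesis using None True by (intro exI[of _ a]) (auto intro: conjugate_refl)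
      next
        case (Cons x h')
        have "conjugate G (ev h \<otimes> a) (a \<otimes> ev h)" by (rule conjugateI) auto
        also have "a \<otimes> ev h = letter x \<otimes> ev h'" by (simp add: Cons ev_Cons)
        finally show ?thesis using None True Cons
          by (intro step[of "Some x" h' False]) auto
      qed
    qed
  next
    case (Some x)
    show ?thesis
    proof (cases y)
      case True
      have "conjugate G ((letter x \<otimes> ev h) \<otimes> a) (a \<otimes> (letter x \<otimes> ev h))" by (rule conjugateI) auto
      also have "a \<otimes> (letter x \<otimes> ev h) = ev (x # h)" by (simp add: ev_Cons)
      finally show ?thesis using True Some
        by (intro exI[of _ "ev (x # h)"]) (auto simp: m_assoc)
    next
      case False
      show ?thesis
      proof (cases h rule: rev_cases)
        case Nil
        then show ?thesis using Some False
          by (intro exI[of _ "letter x"]) (auto intro: conjugate_refl simp: letter_def)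
      next
        case (snoc h' l)
        have c: "conjugate G (letter x \<otimes> ev h) (ev h \<otimes> letter x)" by (rule conjugateI) auto
        have eq: "ev h \<otimes> letter x = ev h' \<otimes> (a \<otimes> (letter l \<otimes> letter x))"
          by (simp add: snoc ev_snoc m_assoc)
        show ?thesis
        proof (cases "l = x")
          case True
          then have "ev h \<otimes> letter x = ev (h' @ [\<not> x])" using eq by (simp add: ev_snoc)
          then show ?thesis using c Some False snoc
            by (intro exI[of _ "ev (h' @ [\<not> x])"]) auto
        next
          case neq: False
          then have "x = (\<not> l)" by auto
          then have "ev h \<otimes> letter x = ev h' \<otimes> a" using eq by simp
          then show ?thesis using c Some False snoc
            by (intro step[of None h' True]) auto
        qed
      qed
    qed
  qed
qed

lemma list_prod_conjugate_cases:
  assumes "set xs \<subseteq> {a, b, inv b}"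
  obtains z where "conjugate G (list_prod G xs) z" "z \<in> {a, b, inv b}"
  | f where "conjugate G (list_prod G xs) (ev f)" "2 * length f \<le> length xs"
proof -
  obtain p h y where 1: "list_prod G xs = pre p \<otimes> (ev h \<otimes> suf y)"
     "size_pre p + 2 * length h + of_bool y \<le> length xs"
    using list_prod_normal_form[OF assms] by blast
  obtain z where "conjugate G (list_prod G xs) z"
    "z \<in> {a, b, inv b} \<or> (\<exists>f. z = ev f \<and> 2 * length f \<le> size_pre p + 2 * length h + of_bool y)"
    using cyclic_reduction[of p h y] unfolding 1(1) by blast
  then show thesis using that 1(2) by (blast intro: le_trans)
qed

lemma conjugate_cases:
  assumes "g \<in> carrier G"
  obtains z where "conjugate G g z" "z \<in> {a, b, inv b}" | f where "conjugate G g (ev f)"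
proof -
  obtain xs where xs: "set xs \<subseteq> {a, b, inv b}" "list_prod G xs = g" using generated[OF assms] by blast
  from xs(1) show thesis
    by (rule list_prod_conjugate_cases) (use that xs(2) in auto)
qed

text \<open>Each generator uses up at most one block, so a word no longer than \<open>e\<close>
  never reaches the right end of \<open>ev e\<close>, and no trailing \<open>a\<close>
  arises.\<close>

lemma list_prod_ev_absorb:
  assumes "set xs \<subseteq> {a, b, inv b}" "length xs \<le> length e"
  shows "\<exists>p h. list_prod G xs \<otimes> ev e = pre p \<otimes> ev h \<and> length e \<le> length h + length xs"
  using assms
proof (induction xs)
  case Nil
  show ?case by (intro exI[of _ None] exI[of _ e]) simp
next
  case (Cons g xs)
  then obtain p h where IH: "list_prod G xs \<otimes> ev e = pre p \<otimes> ev h"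
    "length e \<le> length h + length xs" by auto
  have eq: "list_prod G (g # xs) \<otimes> ev e = g \<otimes> (pre p \<otimes> ev h)"
  proof -
    have "list_prod G xs \<in> carrier G" "g \<in> carrier G" using Cons.prems by (auto intro!: list_prod_closed)
    then show ?thesis by (simp add: m_assoc flip: IH(1))
  qed
  have "g \<in> {a, b, inv b}" using Cons.prems by simp
  then show ?case
  proof (cases rule: generator_cases)
    case 1
    show ?thesis
    proof (cases p)
      case (Some x)
      then show ?thesis using IH 1 eq
        by (intro exI[of _ None] exI[of _ "x # h"]) (simp add: ev_Cons)
    next
      case None
      \<comment> \<open>By the length bound, a block is still left whose \<open>a\<close>
        cancels.\<close>
      have "h \<noteq> []" using IH(2) Cons.prems(2) by auto
      then obtain x h' where "h = x # h'" by (cases h) auto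
      then show ?thesis using IH 1 None eq
        by (intro exI[of _ "Some x"] exI[of _ h']) (simp add: ev_Cons)
    qed
  next
    case (2 x)
    obtain q where q: "letter x \<otimes> pre p = pre q" using letter_pre by blast
    then show ?thesis using IH 2 eq
      by (intro exI[of _ q] exI[of _ h]) (simp flip: m_assoc)
  qed
qed

text \<open>The letter meets the last letter of \<open>f\<close>. Equal letters merge; otherwise
  they cancel, and the \<open>a\<close> before them cancels with the first \<open>a\<close> of
  \<open>ev h\<close>, which leaves the same situation with both words one block shorter. If
  \<open>h\<close> is exhausted, that \<open>a\<close> stays behind as the suffix.\<close>

lemma ev_letter_ev_absorb:
  assumes "length h < length f"
  shows "\<exists>k y. ev f \<otimes> (letter x \<otimes> ev h) = ev k \<otimes> suf y"
  using assms
proof (induction h arbitrary: x f)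
  case Nil
  then obtain f' l where f: "f = f' @ [l]" by (cases f rule: rev_cases) auto
  show ?case
  proof (cases "l = x")
    case True
    then show ?thesis
      by (intro exI[of _ "f' @ [\<not> x]"] exI[of _ False]) (simp add: f ev_snoc m_assoc)
  next
    case False
    then have "x = (\<not> l)" by auto
    then show ?thesis
      by (intro exI[of _ "f'"] exI[of _ True]) (simp add: f ev_snoc m_assoc)
  qed
next
  case (Cons z h)
  then obtain f' l where f: "f = f' @ [l]" by (cases f rule: rev_cases) auto
  show ?case
  proof (cases "l = x")
    case True
    then show ?thesis
      by (intro exI[of _ "f' @ [\<not> x] @ z # h"] exI[of _ False])
        (simp add: f ev_snoc ev_append ev_Cons m_assoc)
  next
    case False
    then have "x = (\<not> l)" by auto
    then have "ev f \<otimes> (letter x \<otimes> ev (z # h)) = ev f' \<otimes> (letter z \<otimes> ev h)"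
      by (simp add: f ev_snoc ev_Cons m_assoc)
    moreover have "length h < length f'" using Cons.prems f by simp
    ultimately show ?thesis using Cons.IH by simp
  qed
qed

text \<open>Multiplying a conjugating element \<open>g\<close> on the right by a large power of \<open>ev e\<close> turns it into
  \<open>ev h\<close>, so that the conjugacy holds in the free monoid; the only other possible form
  \<open>letter x \<otimes> ev h\<close> is excluded by multiplying on the left by a large power of \<open>ev f\<close>.\<close>
lemma conjugate_ev_imp_rotate:
  assumes "conjugate G (ev f) (ev e)" "e \<noteq> []" "f \<noteq> []"
  shows "\<exists>j. f = rotate j e"
proof -
  obtain g where g: "g \<in> carrier G" "ev f \<otimes> g = g \<otimes> ev e"
    using assms unfolding conjugate_def by blast
  obtain xs where xs: "set xs \<subseteq> {a, b, inv b}" "list_prod G xs = g" using generated[OF g(1)] by blast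
  define m where "m = length xs"
  have "length xs \<le> length (concat (replicate m e))"
    using assms(2) by (simp add: m_def length_concat_replicate) (cases e, auto)
  then obtain p h where h: "g \<otimes> ev (concat (replicate m e)) = pre p \<otimes> ev h"
    using list_prod_ev_absorb[OF xs(1)] xs(2) by blast
  \<comment> \<open>Powers of \<open>ev e\<close> commute with \<open>ev e\<close>, so multiplying
    \<open>g\<close> by one of them on the right gives another conjugating element.\<close>
  have comm: "ev f \<otimes> (pre p \<otimes> ev h) = (pre p \<otimes> ev h) \<otimes> ev e"
  proof -
    have c: "ev (concat (replicate m e)) \<otimes> ev e = ev e \<otimes> ev (concat (replicate m e))"
      by (simp add: append_concat_replicate_comm flip: ev_append)
    have "ev f \<otimes> (g \<otimes> ev (concat (replicate m e))) = (ev f \<otimes> g) \<otimes> ev (concat (replicate m e))"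
      using g(1) by (simp add: m_assoc)
    also have "\<dots> = g \<otimes> (ev e \<otimes> ev (concat (replicate m e)))" using g by (simp add: m_assoc)
    also have "\<dots> = (g \<otimes> ev (concat (replicate m e))) \<otimes> ev e" using g(1) by (simp add: m_assoc flip: c)
    finally show ?thesis unfolding h .
  qed
  show ?thesis
  proof (cases p)
    case None
    then have "ev (f @ h) = ev (h @ e)" using comm by (simp add: ev_append)
    then show ?thesis using append_eq_append_imp_rotate ev_inject assms(3) by blast
  next
    case (Some x)
    define n where "n = Suc (length h)"
    have iter: "ev f [^] i \<otimes> (pre p \<otimes> ev h) = (pre p \<otimes> ev h) \<otimes> ev e [^] i" for i :: nat
    proof (induction i)
      case (Suc i)
      have "ev f [^] Suc i \<otimes> (pre p \<otimes> ev h) = ev f [^] i \<otimes> (ev f \<otimes> (pre p \<otimes> ev h))"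
        by (simp add: m_assoc)
      also have "\<dots> = (ev f [^] i \<otimes> (pre p \<otimes> ev h)) \<otimes> ev e" unfolding comm by (simp add: m_assoc)
      also have "\<dots> = (pre p \<otimes> ev h) \<otimes> ev e [^] Suc i" unfolding Suc by (simp add: m_assoc)
      finally show ?case .
    qed simp
    have "length h < length (concat (replicate n f))"
      using assms(3) by (simp add: n_def length_concat_replicate) (cases f, auto)
    then obtain k y where k: "ev (concat (replicate n f)) \<otimes> (letter x \<otimes> ev h) = ev k \<otimes> suf y"
      using ev_letter_ev_absorb by blast
    \<comment> \<open>The same product is read in two ways: as a word with an optional trailing
      \<open>a\<close>, and as a letter followed by a word.\<close>
    have "ev k \<otimes> suf y = letter x \<otimes> ev (h @ concat (replicate n e))"
      using iter[of n] Some k by (simp add: ev_replicate ev_append m_assoc)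
    then show ?thesis
      using letter_ev_neq[of x "h @ concat (replicate n e)" k] by (cases y) auto
  qed
qed

lemma conjugate_ev_rotate: "conjugate G (ev (rotate j e)) (ev e)"
proof (induction j)
  case (Suc j)
  have "conjugate G (ev (rotate1 f)) (ev f)" for f
  proof (cases f)
    case (Cons x f')
    have "ev (rotate1 f) = ev f' \<otimes> ev [x]" "ev f = ev [x] \<otimes> ev f'"
      by (simp_all add: Cons flip: ev_append)
    then show ?thesis using conjugateI(1)[of "ev f'" "ev [x]"] by simp
  qed (simp add: conjugate_refl)
  from conjugate_trans[OF this Suc] show ?case by simp
qed (simp add: conjugate_refl)

lemma conjugate_ev_iff:
  assumes "e \<noteq> []"
  shows "conjugate G (ev f) (ev e) \<longleftrightarrow> (\<exists>j. f = rotate j e)"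
proof (cases "f = []")
  case True
  have "\<not> conjugate G (ev f) (ev e)"
  proof
    assume "conjugate G (ev f) (ev e)"
    then have "conjugate G (ev e) \<one>" using True by (auto dest: conjugate_sym)
    then show False using ev_inject[of e "[]"] assms by (simp add: conjugate_one_iff)
  qed
  moreover have "f \<noteq> rotate j e" for j using True assms by (metis rotate_is_Nil_conv)
  ultimately show ?thesis by blast
next
  case False
  then show ?thesis using assms conjugate_ev_imp_rotate conjugate_ev_rotate by blast
qed

lemma conjugate_ev_iff':
  assumes "e \<noteq> []"
  shows "conjugate G (ev e) (ev f) \<longleftrightarrow> (\<exists>j. f = rotate j e)"
  using conjugate_ev_iff[OF assms, of f] conjugate_sym[of "ev e" "ev f"] conjugate_sym[of "ev f" "ev e"]
  by auto

section \<open>Torsion, minimal length and roots of \<open>ev e\<close>\<close>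

lemma generator_pow_6:
  assumes "z \<in> {a, b, inv b}" shows "z [^] (6::nat) = \<one>"
  using assms
proof (cases rule: generator_cases)
  case 1
  have "a [^] (2::nat) = \<one>" by (simp add: numeral_2_eq_2)
  then show ?thesis using 1 nat_pow_pow[of a 2 3] by simp
next
  case (2 x)
  have "letter x [^] (3::nat) = \<one>" by (simp add: numeral_3_eq_3 m_assoc)
  then show ?thesis using 2 nat_pow_pow[of "letter x" 3 2] by simp
qed

text \<open>The sixth power of \<open>ev e\<close> is \<open>ev\<close> of a nonempty word, hence
  nontrivial, while every power of a generator dies in the sixth power, 6 being a common multiple of
  the orders 2 and 3.\<close>

lemma not_conjugate_pow_generator:
  assumes "e \<noteq> []" "z \<in> {a, b, inv b}"
  shows "\<not> conjugate G (ev e) (z [^] (n::nat))"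
proof
  assume c: "conjugate G (ev e) (z [^] n)"
  have z: "z \<in> carrier G" using assms(2) by auto
  have "conjugate G (ev e [^] (6::nat)) ((z [^] n) [^] (6::nat))"
    by (rule conjugate_nat_pow[OF c]) (use z in auto)
  also have "(z [^] n) [^] (6::nat) = \<one>"
    using generator_pow_6[OF assms(2)] z by (metis mult.commute nat_pow_one nat_pow_pow)
  finally have "ev (concat (replicate 6 e)) = ev []"
    by (simp add: ev_replicate conjugate_one_iff)
  then have "concat (replicate 6 e) = []" by (rule ev_inject)
  then show False using assms(1) by simp
qed

text \<open>Cyclic reduction takes any word for a conjugate to some \<open>ev f\<close> without
  lengthening it, and \<open>f\<close> must be a rotation of \<open>e\<close>; spelling out
  \<open>ev e\<close> attains the bound.\<close>

lemma conjugate_ev_list_prod_iff: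
  assumes "e \<noteq> []"
  shows "(\<exists>xs. set xs \<subseteq> {a, b, inv b} \<and> length xs \<le> m \<and> conjugate G (ev e) (list_prod G xs))
    \<longleftrightarrow> 2 * length e \<le> m" (is "?L \<longleftrightarrow> ?R")
proof
  assume ?L
  then obtain xs where xs: "set xs \<subseteq> {a, b, inv b}" "length xs \<le> m" "conjugate G (ev e) (list_prod G xs)"
    by blast
  have cl: "list_prod G xs \<in> carrier G" using xs(1) generators_closed by simp
  from xs(1) show ?R
  proof (cases rule: list_prod_conjugate_cases)
    case (1 z)
    then have "conjugate G (ev e) (z [^] (1::nat))"
      using xs(3) cl by (intro conjugate_trans[OF xs(3)]) auto
    then show ?thesis using not_conjugate_pow_generator[OF assms 1(2)] by blast
  next
    case (2 f)
    then have "conjugate G (ev e) (ev f)" using xs(3) cl conjugate_trans ev_closed by blast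
    then have "length f = length e" using conjugate_ev_iff'[OF assms] by auto
    then show ?thesis using 2(2) xs(2) by simp
  qed
next
  assume ?R
  have "list_prod G (concat (map (\<lambda>x. [a, letter x]) e)) = ev e"
    by (induction e) (simp_all add: ev_Cons)
  moreover have "set (concat (map (\<lambda>x. [a, letter x]) e)) \<subseteq> {a, b, inv b}"
    by (auto simp: letter_def)
  moreover have "length (concat (map (\<lambda>x. [a, letter x]) e)) = 2 * length e"
    by (induction e) auto
  ultimately show ?L using \<open>?R\<close> conjugate_refl[of "ev e"] ev_closed by metis
qed

text \<open>A root is itself conjugate to a generator, whose powers are excluded, or to some
  \<open>ev f\<close>. In the latter case \<open>e\<close> is a rotation of a proper power of
  \<open>f\<close> and so has the period \<open>length f\<close>.\<close>

lemma primitive_word_imp_not_proper_power: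
  assumes "primitive_word e" "e \<noteq> []" "conjugate G g (ev e)" "g \<in> carrier G"
  shows "\<not> proper_power G g"
proof
  assume "proper_power G g"
  then obtain h n where h: "h \<in> carrier G" "n \<ge> (2::nat)" "conjugate G (ev e) (h [^] n)"
    using proper_power_conjugate[OF assms(3,4)] by auto
  from h(1) show False
  proof (cases rule: conjugate_cases)
    case (1 z)
    then have z: "z \<in> carrier G" by auto
    have "conjugate G (ev e) (z [^] n)"
      using conjugate_trans[OF h(3) conjugate_nat_pow[OF 1(1)]] h(1) z by simp
    then show False using not_conjugate_pow_generator[OF assms(2) 1(2)] by blast
  next
    case (2 f)
    let ?F = "concat (replicate n f)"
    have c: "conjugate G (ev e) (ev ?F)"
      using conjugate_trans[OF h(3) conjugate_nat_pow[OF 2]] h(1) by (simp add: ev_replicate)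
    then have "length ?F = length e" using conjugate_ev_iff'[OF assms(2)] by auto
    then have len: "n * length f = length e" "?F \<noteq> []" using assms(2)
      by (simp_all only: length_concat_replicate flip: length_0_conv) simp_all
    obtain j where j: "e = rotate j ?F"
      using conjugate_ev_imp_rotate[OF c] len(2) assms(2) by blast
    have "rotate (length f) e = rotate j (rotate (length f) ?F)"
      unfolding j by (simp add: rotate_rotate add.commute)
    then have "rotate (length f) e = e" by (simp add: rotate_concat_replicate j)
    moreover have "0 < length f" using len(2) by auto
    moreover have "length f < length e"
    proof -
      have "1 * length f < n * length f" using calculation(2) h(2) by (intro mult_strict_right_mono) auto
      then show ?thesis using len(1) by simp
    qed
    ultimately show False using assms(1) by (simp add: primitive_word_def)
  qed
qed

end

section \<open>The modular group\<close>

lemma mk_mat2_nth [simp]: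
  "mk_mat2 a b c d $ 1 $ 1 = a" "mk_mat2 a b c d $ 1 $ 2 = b"
  "mk_mat2 a b c d $ 2 $ 1 = c" "mk_mat2 a b c d $ 2 $ 2 = d"
  by (simp_all add: mk_mat2_def vector_2)

lemma mat2_cases: obtains a b c d where "M = mk_mat2 a b c d"
proof -
  have "M = mk_mat2 (M$1$1) (M$1$2) (M$2$1) (M$2$2)" by (simp add: vec_eq_iff forall_2)
  then show thesis by (rule that)
qed

lemma mk_mat2_eq_iff [simp]:
  "mk_mat2 a b c d = mk_mat2 a' b' c' d' \<longleftrightarrow> a = a' \<and> b = b' \<and> c = c' \<and> d = d'"
  by (auto simp: vec_eq_iff forall_2)

lemma mk_mat2_mult [simp]: "mk_mat2 a b c d ** mk_mat2 a' b' c' d' =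
    mk_mat2 (a * a' + b * c') (a * b' + b * d') (c * a' + d * c') (c * b' + d * d')"
  by (simp add: vec_eq_iff forall_2 matrix_matrix_mult_def sum_2)

lemma mk_mat2_uminus [simp]: "- mk_mat2 a b c d = mk_mat2 (- a) (- b) (- c) (- d)"
  by (simp add: vec_eq_iff forall_2)

lemma mat_1_eq_mk_mat2: "(mat 1 :: mat2) = mk_mat2 1 0 0 1"
  by (simp add: vec_eq_iff forall_2 mat_def)

lemma det_mk_mat2 [simp]: "det (mk_mat2 a b c d) = a * d - b * c"
  by (simp add: det_2)

lemma trace_mk_mat2 [simp]: "trace (mk_mat2 a b c d) = a + d"
  by (simp add: trace_def sum_2)

lemma minus_mult_mat2: "- M ** N = - (M ** N)" "M ** - N = - (M ** N)" for M N :: mat2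
  by (cases M rule: mat2_cases; cases N rule: mat2_cases; simp)+

lemma proj_class_eq: "proj_class M = {M, - M}"
  by (auto simp: proj_class_def r_coset_def pm_one_def GL2Z_def minus_mult_mat2)

lemma proj_class_eq_iff: "proj_class M = proj_class N \<longleftrightarrow> M = N \<or> M = - N"
  by (auto simp: proj_class_eq doubleton_eq_iff)

lemma carrier_PSL2Z: "carrier PSL2Z = proj_class ` {M. det M = 1}"
  by (auto simp: PSL2Z_def FactGroup_def RCOSETS_def SL2Z_def proj_class_def GL2Z_def r_coset_def)

lemma carrier_PGL2Z: "carrier PGL2Z = proj_class ` {M. invertible M}"
  by (auto simp: PGL2Z_def FactGroup_def RCOSETS_def proj_class_def GL2Z_def r_coset_def)

lemma mult_PSL2Z [simp]: "proj_class M \<otimes>\<^bsub>PSL2Z\<^esub> proj_class N = proj_class (M ** N)"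
  by (auto simp: PSL2Z_def FactGroup_def set_mult_def SL2Z_def proj_class_eq minus_mult_mat2)

lemma mult_PGL2Z [simp]: "proj_class M \<otimes>\<^bsub>PGL2Z\<^esub> proj_class N = proj_class (M ** N)"
  by (auto simp: PGL2Z_def FactGroup_def set_mult_def GL2Z_def proj_class_eq minus_mult_mat2)

lemma one_PSL2Z: "\<one>\<^bsub>PSL2Z\<^esub> = proj_class (mat 1)"
  by (simp add: PSL2Z_def FactGroup_def pm_one_def proj_class_eq)

lemma one_PGL2Z: "\<one>\<^bsub>PGL2Z\<^esub> = proj_class (mat 1)"
  by (simp add: PGL2Z_def FactGroup_def pm_one_def proj_class_eq)

lemma mk_mat2_in_carrier: "a * d - b * c = 1 \<Longrightarrow> proj_class (mk_mat2 a b c d) \<in> carrier PSL2Z"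
  by (simp add: carrier_PSL2Z)

lemma PSL2Z_cases:
  assumes "g \<in> carrier PSL2Z"
  obtains a b c d where "g = proj_class (mk_mat2 a b c d)" "a * d - b * c = 1"
proof -
  obtain M where M: "g = proj_class M" "det M = 1" using assms by (auto simp: carrier_PSL2Z)
  obtain a b c d where "M = mk_mat2 a b c d" by (rule mat2_cases)
  then show thesis using M that by simp
qed

lemma adjugate_mult:
  assumes "a * d - b * c = (1::int)"
  shows "mk_mat2 d (- b) (- c) a ** mk_mat2 a b c d = mat 1"
  using assms by (simp add: mat_1_eq_mk_mat2 algebra_simps)

interpretation PSL: group PSL2Z
proof (rule groupI)
  show "x \<otimes>\<^bsub>PSL2Z\<^esub> y \<in> carrier PSL2Z" if "x \<in> carrier PSL2Z" "y \<in> carrier PSL2Z" for x y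
    using that by (auto simp: carrier_PSL2Z det_mul)
  show "\<one>\<^bsub>PSL2Z\<^esub> \<in> carrier PSL2Z" by (simp add: carrier_PSL2Z one_PSL2Z)
  show "x \<otimes>\<^bsub>PSL2Z\<^esub> y \<otimes>\<^bsub>PSL2Z\<^esub> z = x \<otimes>\<^bsub>PSL2Z\<^esub> (y \<otimes>\<^bsub>PSL2Z\<^esub> z)"
    if "x \<in> carrier PSL2Z" "y \<in> carrier PSL2Z" "z \<in> carrier PSL2Z" for x y z
    using that by (auto simp: carrier_PSL2Z matrix_mul_assoc)
  show "\<one>\<^bsub>PSL2Z\<^esub> \<otimes>\<^bsub>PSL2Z\<^esub> x = x" if "x \<in> carrier PSL2Z" for x
    using that by (auto simp: carrier_PSL2Z one_PSL2Z)
  show "\<exists>y\<in>carrier PSL2Z. y \<otimes>\<^bsub>PSL2Z\<^esub> x = \<one>\<^bsub>PSL2Z\<^esub>" if "x \<in> carrier PSL2Z" for x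
  proof -
    from that obtain a b c d where x: "x = proj_class (mk_mat2 a b c d)" "a * d - b * c = 1"
      by (rule PSL2Z_cases)
    have "proj_class (mk_mat2 d (- b) (- c) a) \<in> carrier PSL2Z"
      using x(2) by (intro mk_mat2_in_carrier) (simp add: algebra_simps)
    moreover have "proj_class (mk_mat2 d (- b) (- c) a) \<otimes>\<^bsub>PSL2Z\<^esub> x = \<one>\<^bsub>PSL2Z\<^esub>"
      using x adjugate_mult by (simp add: one_PSL2Z del: mk_mat2_mult)
    ultimately show ?thesis by blast
  qed
qed

lemma inv_PSL2Z:
  assumes "a * d - b * c = 1"
  shows "inv\<^bsub>PSL2Z\<^esub> (proj_class (mk_mat2 a b c d)) = proj_class (mk_mat2 d (- b) (- c) a)"
proof (rule PSL.inv_equality)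
  show "proj_class (mk_mat2 d (- b) (- c) a) \<otimes>\<^bsub>PSL2Z\<^esub> proj_class (mk_mat2 a b c d) = \<one>\<^bsub>PSL2Z\<^esub>"
    using adjugate_mult[OF assms] by (simp add: one_PSL2Z del: mk_mat2_mult)
qed (use assms in \<open>auto intro!: mk_mat2_in_carrier simp: algebra_simps\<close>)

interpretation PGL: group PGL2Z
proof (rule groupI)
  show "x \<otimes>\<^bsub>PGL2Z\<^esub> y \<in> carrier PGL2Z" if "x \<in> carrier PGL2Z" "y \<in> carrier PGL2Z" for x y
    using that by (auto simp: carrier_PGL2Z invertible_mult)
  show "\<one>\<^bsub>PGL2Z\<^esub> \<in> carrier PGL2Z"
    unfolding carrier_PGL2Z one_PGL2Z by (auto simp: invertible_def intro!: imageI)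
  show "x \<otimes>\<^bsub>PGL2Z\<^esub> y \<otimes>\<^bsub>PGL2Z\<^esub> z = x \<otimes>\<^bsub>PGL2Z\<^esub> (y \<otimes>\<^bsub>PGL2Z\<^esub> z)"
    if "x \<in> carrier PGL2Z" "y \<in> carrier PGL2Z" "z \<in> carrier PGL2Z" for x y z
    using that by (auto simp: carrier_PGL2Z matrix_mul_assoc)
  show "\<one>\<^bsub>PGL2Z\<^esub> \<otimes>\<^bsub>PGL2Z\<^esub> x = x" if "x \<in> carrier PGL2Z" for x
    using that by (auto simp: carrier_PGL2Z one_PGL2Z)
  show "\<exists>y\<in>carrier PGL2Z. y \<otimes>\<^bsub>PGL2Z\<^esub> x = \<one>\<^bsub>PGL2Z\<^esub>" if "x \<in> carrier PGL2Z" for x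
  proof -
    obtain M N where "x = proj_class M" "M ** N = mat 1" "N ** M = mat 1"
      using \<open>x \<in> carrier PGL2Z\<close> by (auto simp: carrier_PGL2Z invertible_def)
    then show ?thesis
      by (intro bexI[of _ "proj_class N"]) (auto simp: carrier_PGL2Z one_PGL2Z invertible_def)
  qed
qed

lemma phi_w_proj_class: "phi_w (proj_class (mk_mat2 a b c d)) = proj_class (mk_mat2 a (- b) (- c) d)"
proof -
  have ww: "w_PGL \<otimes>\<^bsub>PGL2Z\<^esub> w_PGL = \<one>\<^bsub>PGL2Z\<^esub>"
    by (simp add: w_PGL_def one_PGL2Z mat_1_eq_mk_mat2)
  have "mk_mat2 1 0 0 (-1) ** mk_mat2 1 0 0 (-1) = mat 1" by (simp add: mat_1_eq_mk_mat2)
  then have "invertible (mk_mat2 1 0 0 (-1))" unfolding invertible_def by blast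
  then have "w_PGL \<in> carrier PGL2Z" unfolding w_PGL_def carrier_PGL2Z by blast
  then have "inv\<^bsub>PGL2Z\<^esub> w_PGL = w_PGL" using ww by (intro PGL.inv_equality) auto
  then show ?thesis by (simp add: phi_w_def w_PGL_def)
qed

lemma inv_gen_B: "inv\<^bsub>PSL2Z\<^esub> gen_B = proj_class (mk_mat2 1 1 (-1) 0)"
  by (simp add: gen_B_def inv_PSL2Z)

section \<open>Nonnegative matrices and uniqueness of words\<close>

interpretation PSL: generators_2_3 PSL2Z gen_A gen_B
proof
  show "gen_A \<in> carrier PSL2Z" "gen_B \<in> carrier PSL2Z"
    unfolding gen_A_def gen_B_def by (auto intro!: mk_mat2_in_carrier)
qed (simp_all add: gen_A_def gen_B_def one_PSL2Z mat_1_eq_mk_mat2 proj_class_eq_iff)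

lemma letter_eq_proj_class:
  "PSL.letter x = proj_class (if x then mk_mat2 0 (-1) 1 1 else mk_mat2 1 1 (-1) 0)"
  by (cases x) (simp_all add: PSL.letter_def inv_gen_B, simp add: gen_B_def)

text \<open>The factors are, up to sign, \<open>gen_A\<close> times \<open>gen_B\<close> and
  \<open>gen_A\<close> times its inverse, the maps z -> z + 1 and z -> z / (z + 1).\<close>

primrec wmat :: "bool list \<Rightarrow> mat2" where
  "wmat [] = mk_mat2 1 0 0 1"
| "wmat (x # e) = (if x then mk_mat2 1 1 0 1 else mk_mat2 1 0 1 1) ** wmat e"

lemma ev_eq_wmat: "PSL.ev e = proj_class (wmat e)"
proof (induction e)
  case (Cons x e)
  have "gen_A \<otimes>\<^bsub>PSL2Z\<^esub> PSL.letter x = proj_class (if x then mk_mat2 1 1 0 1 else mk_mat2 1 0 1 1)"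
    by (cases x) (simp_all add: letter_eq_proj_class gen_A_def proj_class_eq_iff)
  moreover have "PSL.ev (x # e) = (gen_A \<otimes>\<^bsub>PSL2Z\<^esub> PSL.letter x) \<otimes>\<^bsub>PSL2Z\<^esub> PSL.ev e"
    by (simp add: PSL.ev_Cons PSL.m_assoc)
  ultimately show ?case by (simp add: Cons)
qed (simp add: one_PSL2Z mat_1_eq_mk_mat2)

text \<open>Each factor adds one row to the other, which preserves nonnegativity and the positive
  diagonal. The latter singles out one of the two representatives \<open>M\<close> and
  \<open>- M\<close>.\<close>

lemma wmat_entries:
  obtains a b c d where "wmat e = mk_mat2 a b c d" "a \<ge> 1" "d \<ge> 1" "b \<ge> 0" "c \<ge> 0"
    "a * d - b * c = 1" "True \<in> set e \<Longrightarrow> b \<ge> 1" "False \<in> set e \<Longrightarrow> c \<ge> 1"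
proof -
  have "\<exists>a b c d. wmat e = mk_mat2 a b c d \<and> a \<ge> 1 \<and> d \<ge> 1 \<and> b \<ge> 0 \<and> c \<ge> 0 \<and>
    a * d - b * c = 1 \<and> (True \<in> set e \<longrightarrow> b \<ge> 1) \<and> (False \<in> set e \<longrightarrow> c \<ge> 1)"
  proof (induction e)
    case (Cons x e)
    then obtain a b c d where "wmat e = mk_mat2 a b c d \<and> a \<ge> 1 \<and> d \<ge> 1 \<and> b \<ge> 0 \<and> c \<ge> 0 \<and>
      a * d - b * c = 1 \<and> (True \<in> set e \<longrightarrow> b \<ge> 1) \<and> (False \<in> set e \<longrightarrow> c \<ge> 1)" by blast
    then show ?case by (cases x) (auto simp: algebra_simps)
  qed simp
  then show thesis using that by blast
qed

text \<open>The first letter tells which row dominates the other entrywise. The positive diagonal of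
  the remaining product forbids both at once, and in the identity neither row dominates.\<close>

lemma wmat_inject: "wmat e = wmat f \<Longrightarrow> e = f"
proof (induction e arbitrary: f)
  case Nil
  show ?case
  proof (cases f)
    case (Cons x f')
    obtain a b c d where "wmat f' = mk_mat2 a b c d" "a \<ge> 1" "d \<ge> 1" "b \<ge> 0" "c \<ge> 0"
      by (rule wmat_entries)
    then show ?thesis using Nil Cons by (cases x) auto
  qed simp
next
  case (Cons x e)
  obtain a b c d where e: "wmat e = mk_mat2 a b c d" "a \<ge> 1" "d \<ge> 1" "b \<ge> 0" "c \<ge> 0"
    by (rule wmat_entries)
  show ?case
  proof (cases f)
    case Nil
    then show ?thesis using Cons.prems e by (cases x) auto
  next
    case f: (Cons y f')
    obtain a' b' c' d' where f': "wmat f' = mk_mat2 a' b' c' d'" "a' \<ge> 1" "d' \<ge> 1" "b' \<ge> 0" "c' \<ge> 0"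
      by (rule wmat_entries)
    have "x = y \<and> wmat e = wmat f'" using Cons.prems e f f' by (cases x; cases y) auto
    then show ?thesis using Cons.IH f by simp
  qed
qed

lemma PSL_ev_inject:
  assumes "PSL.ev e = PSL.ev f" shows "e = f"
proof -
  obtain a b c d where e: "wmat e = mk_mat2 a b c d" "a \<ge> 1" by (rule wmat_entries)
  obtain a' b' c' d' where f: "wmat f = mk_mat2 a' b' c' d'" "a' \<ge> 1" by (rule wmat_entries)
  have "wmat e = wmat f" using assms e f by (auto simp: ev_eq_wmat proj_class_eq_iff)
  then show ?thesis by (rule wmat_inject)
qed

text \<open>Signs decide: a letter times a nonnegative matrix has rows of opposite signs, whereas
  \<open>wmat f\<close> has a single sign and its product with the matrix of \<open>gen_A\<close>
  has columns of opposite signs. The positive diagonals exclude the degenerate coincidences.\<close>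

lemma PSL_letter_ev_neq:
  "PSL.letter x \<otimes>\<^bsub>PSL2Z\<^esub> PSL.ev e \<noteq> PSL.ev f"
  "PSL.letter x \<otimes>\<^bsub>PSL2Z\<^esub> PSL.ev e \<noteq> PSL.ev f \<otimes>\<^bsub>PSL2Z\<^esub> gen_A"
proof -
  obtain a b c d where e: "wmat e = mk_mat2 a b c d" "a \<ge> 1" "d \<ge> 1" "b \<ge> 0" "c \<ge> 0"
    by (rule wmat_entries)
  obtain a' b' c' d' where f: "wmat f = mk_mat2 a' b' c' d'" "a' \<ge> 1" "d' \<ge> 1" "b' \<ge> 0" "c' \<ge> 0"
    by (rule wmat_entries)
  show "PSL.letter x \<otimes>\<^bsub>PSL2Z\<^esub> PSL.ev e \<noteq> PSL.ev f"
    using e f by (auto simp: letter_eq_proj_class ev_eq_wmat proj_class_eq_iff)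
  show "PSL.letter x \<otimes>\<^bsub>PSL2Z\<^esub> PSL.ev e \<noteq> PSL.ev f \<otimes>\<^bsub>PSL2Z\<^esub> gen_A"
    unfolding letter_eq_proj_class ev_eq_wmat unfolding gen_A_def
    using e f by (auto simp: proj_class_eq_iff)
qed

section \<open>Generation of the modular group\<close>

definition word_generated :: "mat2 set \<Rightarrow> bool" where
  "word_generated g \<longleftrightarrow>
     (\<exists>xs. set xs \<subseteq> {gen_A, gen_B, inv\<^bsub>PSL2Z\<^esub> gen_B} \<and> list_prod PSL2Z xs = g)"

lemma word_generated_mult:
  assumes "word_generated g" "word_generated h"
  shows "word_generated (g \<otimes>\<^bsub>PSL2Z\<^esub> h)"
proof -
  obtain xs ys where "set xs \<subseteq> {gen_A, gen_B, inv\<^bsub>PSL2Z\<^esub> gen_B}" "list_prod PSL2Z xs = g"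
    "set ys \<subseteq> {gen_A, gen_B, inv\<^bsub>PSL2Z\<^esub> gen_B}" "list_prod PSL2Z ys = h"
    using assms unfolding word_generated_def by blast
  then show ?thesis unfolding word_generated_def
    by (intro exI[of _ "xs @ ys"]) (simp add: PSL.list_prod_append PSL.generators_closed)
qed

lemma word_generated_one: "word_generated \<one>\<^bsub>PSL2Z\<^esub>"
  unfolding word_generated_def by (rule exI[of _ "[]"]) simp

lemma word_generated_generators:
  assumes "g \<in> {gen_A, gen_B, inv\<^bsub>PSL2Z\<^esub> gen_B}" shows "word_generated g"
  unfolding word_generated_def using assms by (intro exI[of _ "[g]"]) auto

text \<open>\<open>gen_A\<close> times \<open>gen_B\<close> is the translation by 1, and
  \<open>inv gen_B\<close> times \<open>gen_A\<close> is its inverse.\<close>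

lemma word_generated_translation: "word_generated (proj_class (mk_mat2 1 n 0 1))"
proof (induction n rule: int_induct[of _ 0])
  case base
  then show ?case using word_generated_one by (simp add: one_PSL2Z mat_1_eq_mk_mat2)
next
  case (step1 i)
  have "proj_class (mk_mat2 1 (i + 1) 0 1) = gen_A \<otimes>\<^bsub>PSL2Z\<^esub> gen_B \<otimes>\<^bsub>PSL2Z\<^esub> proj_class (mk_mat2 1 i 0 1)"
    by (simp add: gen_A_def gen_B_def proj_class_eq_iff)
  then show ?case using step1 by (simp add: word_generated_mult word_generated_generators del: mult_PSL2Z)
next
  case (step2 i)
  have "proj_class (mk_mat2 1 (i - 1) 0 1) = inv\<^bsub>PSL2Z\<^esub> gen_B \<otimes>\<^bsub>PSL2Z\<^esub> gen_A \<otimes>\<^bsub>PSL2Z\<^esub> proj_class (mk_mat2 1 i 0 1)"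
    by (simp add: gen_A_def inv_gen_B proj_class_eq_iff)
  then show ?case using step2 by (simp add: word_generated_mult word_generated_generators del: mult_PSL2Z)
qed

text \<open>The Euclidean algorithm on the first column: translations perform the division steps and
  \<open>gen_A\<close> the swaps.\<close>

lemma word_generated_PSL2Z:
  assumes "a * d - b * c = 1"
  shows "word_generated (proj_class (mk_mat2 a b c d))"
  using assms
proof (induction "nat \<bar>c\<bar>" arbitrary: a b c d rule: less_induct)
  case less
  show ?case
  proof (cases "c = 0")
    case True
    then have "a * d = 1" using less.prems by simp
    then have "a = 1 \<and> d = 1 \<or> a = -1 \<and> d = -1" using zmult_eq_1_iff by blast
    \<comment> \<open>The common diagonal entry \<open>a\<close> is a sign; taking it out leaves the
      translation by \<open>a * b\<close>.\<close>
    then have "proj_class (mk_mat2 a b c d) = proj_class (mk_mat2 1 (a * b) 0 1)"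
      using True by (auto simp: proj_class_eq_iff)
    then show ?thesis using word_generated_translation by simp
  next
    case False
    define q where "q = a div c"
    define r where "r = a mod c"
    have a: "a = q * c + r" by (simp add: q_def r_def)
    have "\<bar>r\<bar> < \<bar>c\<bar>" using False by (simp add: r_def abs_mod_less)
    then have lt: "nat \<bar>r\<bar> < nat \<bar>c\<bar>" by simp
    have det: "(- c) * (b - q * d) - (- d) * r = 1" using less.prems by (simp add: a algebra_simps)
    \<comment> \<open>The product on the right is minus the given matrix; its last factor has the
      remainder \<open>r\<close> as lower left entry.\<close>
    have "proj_class (mk_mat2 a b c d) = proj_class (mk_mat2 1 q 0 1) \<otimes>\<^bsub>PSL2Z\<^esub> gen_A
        \<otimes>\<^bsub>PSL2Z\<^esub> proj_class (mk_mat2 (- c) (- d) r (b - q * d))"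
      by (simp add: gen_A_def proj_class_eq_iff a algebra_simps)
    then show ?thesis using less.hyps[OF lt det]
      by (simp add: word_generated_mult word_generated_generators word_generated_translation del: mult_PSL2Z)
  qed
qed

lemma free_product_2_3_PSL2Z: "free_product_2_3 PSL2Z gen_A gen_B"
proof
  show "\<exists>xs. set xs \<subseteq> {gen_A, gen_B, inv\<^bsub>PSL2Z\<^esub> gen_B} \<and> list_prod PSL2Z xs = g"
    if "g \<in> carrier PSL2Z" for g
    using that by (rule PSL2Z_cases) (use word_generated_PSL2Z word_generated_def in blast)
qed (rule PSL_ev_inject PSL_letter_ev_neq | assumption)+

section \<open>Inert classes\<close>

interpretation PSL: free_product_2_3 PSL2Z gen_A gen_B
  by (rule free_product_2_3_PSL2Z)

section \<open>The action of \<open>phi_w\<close> on word classes\<close>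

lemma phi_w_closed [simp]: "g \<in> carrier PSL2Z \<Longrightarrow> phi_w g \<in> carrier PSL2Z"
  by (elim PSL2Z_cases) (auto simp: phi_w_proj_class intro!: mk_mat2_in_carrier)

lemma phi_w_phi_w: "g \<in> carrier PSL2Z \<Longrightarrow> phi_w (phi_w g) = g"
  by (elim PSL2Z_cases) (simp add: phi_w_proj_class)

lemma phi_w_mult:
  assumes "g \<in> carrier PSL2Z" "h \<in> carrier PSL2Z"
  shows "phi_w (g \<otimes>\<^bsub>PSL2Z\<^esub> h) = phi_w g \<otimes>\<^bsub>PSL2Z\<^esub> phi_w h"
  using assms by (elim PSL2Z_cases) (simp add: phi_w_proj_class algebra_simps)

text \<open>\<open>phi_w\<close> fixes \<open>gen_A\<close> and sends a letter to its inverse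
  conjugated by \<open>gen_A\<close>. All these conjugations amount to a single one of the
  complementary word.\<close>

lemma phi_w_ev: "phi_w (PSL.ev e) = gen_A \<otimes>\<^bsub>PSL2Z\<^esub> (PSL.ev (map Not e) \<otimes>\<^bsub>PSL2Z\<^esub> gen_A)"
proof (induction e)
  case Nil
  have "phi_w \<one>\<^bsub>PSL2Z\<^esub> = \<one>\<^bsub>PSL2Z\<^esub>" by (simp add: one_PSL2Z mat_1_eq_mk_mat2 phi_w_proj_class)
  then show ?case by simp
next
  case (Cons x e)
  have A: "phi_w gen_A = gen_A" by (simp add: gen_A_def phi_w_proj_class proj_class_eq_iff)
  have l: "phi_w (PSL.letter x) = gen_A \<otimes>\<^bsub>PSL2Z\<^esub> (PSL.letter (\<not> x) \<otimes>\<^bsub>PSL2Z\<^esub> gen_A)"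
    by (cases x) (simp_all add: letter_eq_proj_class gen_A_def phi_w_proj_class proj_class_eq_iff)
  show ?case by (simp add: PSL.ev_Cons phi_w_mult A l Cons PSL.m_assoc)
qed

lemma phi_w_image_conj_class:
  assumes g: "g \<in> carrier PSL2Z"
  shows "phi_w ` conj_class PSL2Z g = conj_class PSL2Z (phi_w g)"
proof -
  have conj: "conjugate PSL2Z (phi_w x) (phi_w y)"
    if xy: "conjugate PSL2Z x y" "x \<in> carrier PSL2Z" "y \<in> carrier PSL2Z" for x y
  proof -
    obtain h where h: "h \<in> carrier PSL2Z" "x \<otimes>\<^bsub>PSL2Z\<^esub> h = h \<otimes>\<^bsub>PSL2Z\<^esub> y"
      using xy(1) unfolding conjugate_def by blast
    have "phi_w x \<otimes>\<^bsub>PSL2Z\<^esub> phi_w h = phi_w h \<otimes>\<^bsub>PSL2Z\<^esub> phi_w y"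
      using arg_cong[OF h(2), of phi_w] phi_w_mult h(1) xy(2,3) by simp
    then show ?thesis unfolding conjugate_def using h(1) phi_w_closed by blast
  qed
  show ?thesis
  proof (intro Set.set_eqI iffI)
    fix y assume "y \<in> phi_w ` conj_class PSL2Z g"
    then show "y \<in> conj_class PSL2Z (phi_w g)" using conj g by (auto simp: PSL.conj_class_eq)
  next
    fix y assume "y \<in> conj_class PSL2Z (phi_w g)"
    then have y: "y \<in> carrier PSL2Z" "conjugate PSL2Z (phi_w g) y" using g by (auto simp: PSL.conj_class_eq)
    then have "phi_w y \<in> conj_class PSL2Z g"
      using conj[OF y(2)] g by (simp add: PSL.conj_class_eq phi_w_phi_w)
    then show "y \<in> phi_w ` conj_class PSL2Z g" using y(1) phi_w_phi_w by (metis image_eqI)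
  qed
qed

definition word_class :: "bool list \<Rightarrow> mat2 set set" where
  "word_class e = conj_class PSL2Z (PSL.ev e)"

lemma word_class_eq_iff:
  assumes "e \<noteq> []" shows "word_class e = word_class f \<longleftrightarrow> (\<exists>j. f = rotate j e)"
  unfolding word_class_def using PSL.conj_class_eq_iff PSL.conjugate_ev_iff'[OF assms] by simp

lemma phi_w_word_class: "phi_w ` word_class e = word_class (map Not e)"
proof -
  have "conjugate PSL2Z (gen_A \<otimes>\<^bsub>PSL2Z\<^esub> (PSL.ev (map Not e) \<otimes>\<^bsub>PSL2Z\<^esub> gen_A))
      (PSL.ev (map Not e) \<otimes>\<^bsub>PSL2Z\<^esub> gen_A \<otimes>\<^bsub>PSL2Z\<^esub> gen_A)"
    by (rule PSL.conjugateI) auto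
  then have "conjugate PSL2Z (phi_w (PSL.ev e)) (PSL.ev (map Not e))"
    by (simp add: phi_w_ev PSL.m_assoc)
  then show ?thesis
    unfolding word_class_def by (simp add: phi_w_image_conj_class PSL.conj_class_eq_iff)
qed

lemma phi_w_word_class_fixed_iff:
  assumes "e \<noteq> []" shows "phi_w ` word_class e = word_class e \<longleftrightarrow> self_complementary e"
  unfolding phi_w_word_class self_complementary_def
  using word_class_eq_iff[OF assms, of "map Not e"] by metis

section \<open>Length, hyperbolicity and primitivity of word classes\<close>

lemma word_length_le_iff:
  assumes "g \<in> carrier PSL2Z"
  shows "word_length g \<le> m \<longleftrightarrow> (\<exists>xs. set xs \<subseteq> {gen_A, gen_B, inv\<^bsub>PSL2Z\<^esub> gen_B} \<and>
    length xs \<le> m \<and> list_prod PSL2Z xs = g)"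
proof
  let ?P = "\<lambda>n. \<exists>xs. set xs \<subseteq> {gen_A, gen_B, inv\<^bsub>PSL2Z\<^esub> gen_B} \<and> length xs = n \<and> list_prod PSL2Z xs = g"
  have "\<exists>n. ?P n" using PSL.generated[OF assms] by blast
  then have "?P (word_length g)" unfolding word_length_def by (rule LeastI_ex)
  then obtain xs where "set xs \<subseteq> {gen_A, gen_B, inv\<^bsub>PSL2Z\<^esub> gen_B}" "length xs = word_length g"
    "list_prod PSL2Z xs = g" by blast
  then show "\<exists>xs. set xs \<subseteq> {gen_A, gen_B, inv\<^bsub>PSL2Z\<^esub> gen_B} \<and> length xs \<le> m \<and> list_prod PSL2Z xs = g"
    if "word_length g \<le> m" using that by (intro exI[of _ xs]) simp
next
  assume "\<exists>xs. set xs \<subseteq> {gen_A, gen_B, inv\<^bsub>PSL2Z\<^esub> gen_B} \<and> length xs \<le> m \<and> list_prod PSL2Z xs = g"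
  then obtain xs where xs: "set xs \<subseteq> {gen_A, gen_B, inv\<^bsub>PSL2Z\<^esub> gen_B}" "length xs \<le> m" "list_prod PSL2Z xs = g"
    by blast
  have "word_length g \<le> length xs" unfolding word_length_def using xs by (intro Least_le exI[of _ xs]) simp
  then show "word_length g \<le> m" using xs(2) by simp
qed

lemma class_length_le_iff:
  assumes "C \<noteq> {}" shows "class_length C \<le> m \<longleftrightarrow> (\<exists>g\<in>C. word_length g \<le> m)"
proof
  have "class_length C \<in> word_length ` C"
    unfolding class_length_def using assms by (intro Inf_nat_def1) simp
  then show "\<exists>g\<in>C. word_length g \<le> m" if "class_length C \<le> m" using that by auto
next
  assume "\<exists>g\<in>C. word_length g \<le> m"
  then obtain g where g: "g \<in> C" "word_length g \<le> m" by blast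
  have "class_length C \<le> word_length g"
    unfolding class_length_def using g(1) by (intro cInf_lower) auto
  then show "class_length C \<le> m" using g(2) by simp
qed

lemma ev_in_word_class: "PSL.ev e \<in> word_class e"
  by (simp add: word_class_def PSL.conj_class_eq PSL.conjugate_refl)

lemma class_length_word_class_le_iff:
  assumes "e \<noteq> []" shows "class_length (word_class e) \<le> m \<longleftrightarrow> 2 * length e \<le> m"
proof -
  have "class_length (word_class e) \<le> m \<longleftrightarrow> (\<exists>g\<in>word_class e. word_length g \<le> m)"
    using ev_in_word_class by (intro class_length_le_iff) blast
  also have "\<dots> \<longleftrightarrow> (\<exists>xs. set xs \<subseteq> {gen_A, gen_B, inv\<^bsub>PSL2Z\<^esub> gen_B} \<and> length xs \<le> m \<and>
      conjugate PSL2Z (PSL.ev e) (list_prod PSL2Z xs))"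
    using PSL.list_prod_closed[OF PSL.generators_closed]
    by (auto simp: word_class_def PSL.conj_class_eq word_length_le_iff)
  finally show ?thesis using PSL.conjugate_ev_list_prod_iff[OF assms] by simp
qed

text \<open>Both letters occur, so \<open>b * c\<close> is at least 1; then \<open>a * d\<close> is
  at least 2, and two positive integers with such a product have sum above 2.\<close>

lemma ev_in_prim_hyp:
  assumes "self_complementary e" "e \<noteq> []" "primitive_word e"
  shows "PSL.ev e \<in> prim_hyp"
proof -
  obtain a b c d where e: "wmat e = mk_mat2 a b c d" "a \<ge> 1" "d \<ge> 1" "a * d - b * c = 1" "b \<ge> 1" "c \<ge> 1"
    using self_complementary_letters[OF assms(1,2)] by (metis wmat_entries)
  have "1 * 1 \<le> b * c" using e by (intro mult_mono) auto
  then have "\<not> (a = 1 \<and> d = 1)" using e(4) by auto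
  then have "\<bar>trace (wmat e)\<bar> > 2" using e by auto
  then have "hyperbolic (PSL.ev e)"
    unfolding hyperbolic_def using PSL.ev_closed by (auto simp: ev_eq_wmat proj_class_eq)
  moreover have "\<not> proper_power PSL2Z (PSL.ev e)"
    using assms by (intro PSL.primitive_word_imp_not_proper_power[of e] PSL.conjugate_refl) auto
  ultimately show ?thesis by (simp add: prim_hyp_def)
qed

lemma word_class_inert:
  assumes "self_complementary e" "e \<noteq> []" "primitive_word e"
  shows "word_class e \<in> inert_classes"
proof -
  have "PSL.ev e \<in> prim_hyp_products"
    unfolding prim_hyp_products_def
    by (rule CollectI, rule exI[of _ "[(PSL.ev e, 1)]"]) (simp add: ev_in_prim_hyp[OF assms])
  then show ?thesis
    using phi_w_word_class_fixed_iff[OF assms(2)] assms(1)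
    unfolding inert_classes_def word_class_def by (intro CollectI exI[of _ "PSL.ev e"]) simp
qed

lemma word_class_primitive:
  assumes "e \<noteq> []" "primitive_word e" shows "primitive_class (word_class e)"
  unfolding primitive_class_def
proof
  fix g assume "g \<in> word_class e"
  then have g: "g \<in> carrier PSL2Z" "conjugate PSL2Z (PSL.ev e) g"
    by (auto simp: word_class_def PSL.conj_class_eq)
  then have "conjugate PSL2Z g (PSL.ev e)" by (intro PSL.conjugate_sym[OF g(2)]) auto
  then show "\<not> proper_power PSL2Z g"
    using assms g(1) by (intro PSL.primitive_word_imp_not_proper_power)
qed

section \<open>Enclosing the inert classes\<close>

lemma prim_hyp_products_closed: "p \<in> prim_hyp_products \<Longrightarrow> p \<in> carrier PSL2Z"
proof -
  assume "p \<in> prim_hyp_products"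
  then obtain xs :: "(mat2 set \<times> int) list" where xs: "fst ` set xs \<subseteq> prim_hyp"
    "p = list_prod PSL2Z (map (\<lambda>(p, k). p [^]\<^bsub>PSL2Z\<^esub> k) xs)"
    unfolding prim_hyp_products_def by blast
  have "set (map (\<lambda>(p, k). p [^]\<^bsub>PSL2Z\<^esub> k) xs) \<subseteq> carrier PSL2Z"
    using xs(1) by (auto simp: prim_hyp_def hyperbolic_def intro!: PSL.int_pow_closed)
  then show ?thesis unfolding xs(2) by (rule PSL.list_prod_closed)
qed

text \<open>From membership in \<open>prim_hyp_products\<close> only membership in the group is
  kept. The four torsion classes are included without deciding whether they are inert.\<close>

lemma inert_upto_subset:
  "inert_upto (2 * t) \<subseteq> conj_class PSL2Z ` {\<one>\<^bsub>PSL2Z\<^esub>, gen_A, gen_B, inv\<^bsub>PSL2Z\<^esub> gen_B} \<union>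
     word_class ` {e. e \<noteq> [] \<and> length e \<le> t \<and> self_complementary e}"
proof
  fix C assume "C \<in> inert_upto (2 * t)"
  then obtain p where p: "C = conj_class PSL2Z p" "p \<in> prim_hyp_products" "phi_w ` C = C"
    "class_length C \<le> 2 * t" by (auto simp: inert_upto_def inert_classes_def)
  have pc: "p \<in> carrier PSL2Z" using prim_hyp_products_closed[OF p(2)] .
  then show "C \<in> conj_class PSL2Z ` {\<one>\<^bsub>PSL2Z\<^esub>, gen_A, gen_B, inv\<^bsub>PSL2Z\<^esub> gen_B} \<union>
     word_class ` {e. e \<noteq> [] \<and> length e \<le> t \<and> self_complementary e}"
  proof (cases rule: PSL.conjugate_cases)
    case (1 z)
    then have "conj_class PSL2Z p = conj_class PSL2Z z"
      using PSL.conj_class_eq_iff[of p z] pc by auto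
    then show ?thesis using 1(2) p(1) by auto
  next
    case (2 e)
    then have C: "C = word_class e"
      unfolding p(1) word_class_def using PSL.conj_class_eq_iff pc by simp
    show ?thesis
    proof (cases "e = []")
      case True
      then show ?thesis using C by (simp add: word_class_def)
    next
      case False
      then have "self_complementary e" "length e \<le> t"
        using p(3,4) class_length_word_class_le_iff[OF False] phi_w_word_class_fixed_iff[OF False]
        unfolding C by auto
      then show ?thesis using C False by blast
    qed
  qed
qed

text \<open>A word of length \<open>2 * s\<close> gives a class of length \<open>4 * s\<close>,
  which is at most \<open>2 * t\<close> iff \<open>s \<le> t div 2\<close>.\<close>

definition primitive_sc_word_classes :: "nat \<Rightarrow> mat2 set set set" where
  "primitive_sc_word_classes t = (\<Union>s\<in>{1..t div 2}. word_class ` primitive_sc_words (2 * s))"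

lemma primitive_sc_word_classes_subset:
  "primitive_sc_word_classes t \<subseteq> {C \<in> inert_upto (2 * t). primitive_class C}"
proof
  fix C assume "C \<in> primitive_sc_word_classes t"
  then obtain s e where s: "1 \<le> s" "s \<le> t div 2" "e \<in> primitive_sc_words (2 * s)" "C = word_class e"
    by (auto simp: primitive_sc_word_classes_def)
  then have e: "e \<noteq> []" "self_complementary e" "primitive_word e" "length e \<le> t"
    by (auto simp: primitive_sc_words_def)
  then show "C \<in> {C \<in> inert_upto (2 * t). primitive_class C}"
    using word_class_inert word_class_primitive class_length_word_class_le_iff[OF e(1)]
    by (simp add: inert_upto_def s(4))
qed

text \<open>The upper half of the enclosure, with \<open>primitive_sc_word_classes_subset\<close> as
  the lower half; the excess over the latter is the error term.\<close>

lemma inert_upto_subset_primitive: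
  "inert_upto (2 * t) \<subseteq> primitive_sc_word_classes t \<union> word_class ` nonprimitive_sc_words t \<union>
     conj_class PSL2Z ` {\<one>\<^bsub>PSL2Z\<^esub>, gen_A, gen_B, inv\<^bsub>PSL2Z\<^esub> gen_B}"
proof -
  have "word_class e \<in> primitive_sc_word_classes t \<union> word_class ` nonprimitive_sc_words t"
    if e: "e \<noteq> []" "length e \<le> t" "self_complementary e" for e
  proof (cases "primitive_word e")
    case True
    then have pe: "e \<in> primitive_sc_words (length e)" using e by (simp add: primitive_sc_words_def)
    have "length e > 0" using e(1) by simp
    with pe obtain u where u: "e = u @ map Not u" "length e = 2 * length u" by (rule primitive_sc_words_even)
    have "length u \<in> {1..t div 2}" unfolding atLeastAtMost_iff
      using u(2) e(2) \<open>length e > 0\<close> by linarith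
    moreover have "e \<in> primitive_sc_words (2 * length u)" using pe u(2) by (simp only:)
    ultimately show ?thesis unfolding primitive_sc_word_classes_def by blast
  next
    case False
    then show ?thesis using e by (simp add: nonprimitive_sc_words_def)
  qed
  then show ?thesis using inert_upto_subset[of t] by blast
qed

lemma finite_primitive_sc_word_classes: "finite (primitive_sc_word_classes t)"
  by (simp add: primitive_sc_word_classes_def finite_primitive_sc_words)

lemma finite_inert_upto: "finite (inert_upto (2 * t))"
  by (rule finite_subset[OF inert_upto_subset_primitive])
    (simp add: finite_primitive_sc_word_classes finite_nonprimitive_sc_words)

lemma card_inert_upto_le:
  "card (inert_upto (2 * t)) \<le> card (primitive_sc_word_classes t) + (t + 1) * 2 ^ (t div 4 + 1) + 4"
proof -
  let ?T = "{\<one>\<^bsub>PSL2Z\<^esub>, gen_A, gen_B, inv\<^bsub>PSL2Z\<^esub> gen_B}"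
  let ?N = "word_class ` nonprimitive_sc_words t"
  have "card (inert_upto (2 * t)) \<le> card (primitive_sc_word_classes t \<union> ?N \<union> conj_class PSL2Z ` ?T)"
    by (rule card_mono[OF _ inert_upto_subset_primitive])
      (simp add: finite_primitive_sc_word_classes finite_nonprimitive_sc_words)
  also have "\<dots> \<le> card (primitive_sc_word_classes t) + card ?N + card (conj_class PSL2Z ` ?T)"
    by (intro order.trans[OF card_Un_le] add_mono card_Un_le order_refl)
  also have "card ?N \<le> card (nonprimitive_sc_words t)"
    by (rule card_image_le) (rule finite_nonprimitive_sc_words)
  also have "\<dots> \<le> (t + 1) * 2 ^ (t div 4 + 1)" by (rule card_nonprimitive_sc_words)
  also have "card (conj_class PSL2Z ` ?T) \<le> card ?T" by (rule card_image_le) simp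
  also have "card ?T \<le> 4" using card_length[of "[\<one>\<^bsub>PSL2Z\<^esub>, gen_A, gen_B, inv\<^bsub>PSL2Z\<^esub> gen_B]"] by simp
  finally show ?thesis by simp
qed

text \<open>The fibres of \<open>word_class\<close> are rotation orbits, and a primitive word of
  length \<open>n\<close> has \<open>n\<close> distinct rotations.\<close>

lemma card_word_class_image:
  assumes "n > 0"
  shows "n * card (word_class ` primitive_sc_words n) = card (primitive_sc_words n)"
proof -
  let ?Q = "primitive_sc_words n"
  have fibre: "card {e \<in> ?Q. word_class e = C} = n" if C: "C \<in> word_class ` ?Q" for C
  proof -
    obtain e where e: "e \<in> ?Q" "C = word_class e" using C by blast
    then have e': "length e = n" "primitive_word e" "e \<noteq> []"
      using assms by (auto simp: primitive_sc_words_def)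
    have "{f \<in> ?Q. word_class f = C} = (\<lambda>j. rotate j e) ` {..<length e}"
    proof (intro Set.set_eqI iffI)
      fix f assume "f \<in> {f \<in> ?Q. word_class f = C}"
      then have "word_class e = word_class f" using e(2) by simp
      then obtain j where "f = rotate j e" using word_class_eq_iff[OF e'(3)] by blast
      then have "f = rotate (j mod length e) e" using rotate_conv_mod by metis
      then show "f \<in> (\<lambda>j. rotate j e) ` {..<length e}" using e'(3) by auto
    next
      fix f assume "f \<in> (\<lambda>j. rotate j e) ` {..<length e}"
      then obtain j where "f = rotate j e" by blast
      then show "f \<in> {f \<in> ?Q. word_class f = C}"
        using primitive_sc_words_rotate[OF e(1)] word_class_eq_iff[OF e'(3), of f] e(2) by auto
    qed
    then show ?thesis using card_rotations[OF e'(2)] e'(1) by simp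
  qed
  have "card ?Q = (\<Sum>C\<in>word_class ` ?Q. card {e \<in> ?Q. word_class e = C})"
    using card_eq_sum sum.image_gen[OF finite_primitive_sc_words, of "\<lambda>_. 1::nat" n word_class] by simp
  also have "\<dots> = card (word_class ` ?Q) * n" using fibre by simp
  finally show ?thesis by (simp add: mult.commute)
qed

lemma card_primitive_sc_word_classes:
  "real (card (primitive_sc_word_classes t)) =
     (\<Sum>s=1..t div 2. real (card (primitive_sc_words (2 * s))) / (2 * real s))"
proof -
  \<comment> \<open>Rotation preserves length, so classes for different \<open>s\<close> are
    different.\<close>
  have disj: "word_class ` primitive_sc_words (2 * s) \<inter> word_class ` primitive_sc_words (2 * r) = {}"
    if "s \<ge> 1" "s \<noteq> r" for s r
  proof -
    have False if "e \<in> primitive_sc_words (2 * s)" "f \<in> primitive_sc_words (2 * r)"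
      "word_class e = word_class f" for e f
    proof -
      have "e \<noteq> []" using that(1) \<open>s \<ge> 1\<close> by (auto simp: primitive_sc_words_def)
      then have "length f = length e" using word_class_eq_iff that(3) by force
      then show False using that(1,2) \<open>s \<noteq> r\<close> by (simp add: primitive_sc_words_def)
    qed
    then show ?thesis by blast
  qed
  have "card (primitive_sc_word_classes t) = (\<Sum>s=1..t div 2. card (word_class ` primitive_sc_words (2 * s)))"
    unfolding primitive_sc_word_classes_def
    by (rule card_UN_disjoint) (use disj in \<open>auto simp: finite_primitive_sc_words\<close>)
  also have "real \<dots> = (\<Sum>s=1..t div 2. real (card (primitive_sc_words (2 * s))) / (2 * real s))"
    unfolding of_nat_sum
  proof (intro sum.cong refl)
    fix s assume s: "s \<in> {1..t div 2}"
    have "real (2 * s * card (word_class ` primitive_sc_words (2 * s))) = real (card (primitive_sc_words (2 * s)))"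
      using card_word_class_image[of "2 * s"] s by simp
    then show "real (card (word_class ` primitive_sc_words (2 * s))) = real (card (primitive_sc_words (2 * s))) / (2 * real s)"
      using s by (simp add: field_simps)
  qed
  finally show ?thesis .
qed

lemma card_primitive_sc_word_classes_le:
  "real (card (primitive_sc_word_classes t)) \<le> (\<Sum>s=1..t div 2. 2 ^ s / (2 * real s))"
  unfolding card_primitive_sc_word_classes
proof (intro sum_mono divide_right_mono)
  fix s assume "s \<in> {1..t div 2}"
  then have "real (card (primitive_sc_words (2 * s))) \<le> real (2 ^ s)"
    by (intro of_nat_mono card_primitive_sc_words_le) simp
  then show "real (card (primitive_sc_words (2 * s))) \<le> 2 ^ s" by simp
qed simp

text \<open>Each summand falls short by at most the number of nonprimitive words of length up to
  \<open>t\<close>. The gain from dividing this error by \<open>2 * s\<close> is given away, the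
  error being exponentially smaller than the main term.\<close>

lemma card_primitive_sc_word_classes_ge:
  "(\<Sum>s=1..t div 2. 2 ^ s / (2 * real s)) - real t * (real t + 1) * 2 ^ (t div 4 + 1) \<le>
     real (card (primitive_sc_word_classes t))"
proof -
  let ?K = "(real t + 1) * 2 ^ (t div 4 + 1)"
  have "(\<Sum>s=1..t div 2. 2 ^ s / (2 * real s) - ?K) \<le> real (card (primitive_sc_word_classes t))"
    unfolding card_primitive_sc_word_classes
  proof (intro sum_mono)
    fix s assume s: "s \<in> {1..t div 2}"
    have "2 ^ s \<le> card (primitive_sc_words (2 * s)) + card (nonprimitive_sc_words (2 * s))"
      using s by (intro card_primitive_sc_words_ge) simp
    also have "card (nonprimitive_sc_words (2 * s)) \<le> card (nonprimitive_sc_words t)"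
      using s by (intro card_mono finite_nonprimitive_sc_words) (auto simp: nonprimitive_sc_words_def)
    also have "\<dots> \<le> (t + 1) * 2 ^ (t div 4 + 1)" by (rule card_nonprimitive_sc_words)
    finally have "real (2 ^ s) \<le> real (card (primitive_sc_words (2 * s)) + (t + 1) * 2 ^ (t div 4 + 1))"
      by (simp only: of_nat_le_iff)
    then have "2 ^ s - ?K \<le> real (card (primitive_sc_words (2 * s)))" by (simp add: distrib_right)
    then have "(2 ^ s - ?K) / (2 * real s) \<le> real (card (primitive_sc_words (2 * s))) / (2 * real s)"
      by (rule divide_right_mono) simp
    moreover have "?K / (2 * real s) \<le> ?K / 1" using s by (intro divide_left_mono) auto
    ultimately show "2 ^ s / (2 * real s) - ?K \<le> real (card (primitive_sc_words (2 * s))) / (2 * real s)"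
      by (simp add: diff_divide_distrib)
  qed
  moreover have "real (t div 2) * ?K \<le> real t * ?K" by (intro mult_right_mono) auto
  moreover have "(\<Sum>s=1..t div 2. 2 ^ s / (2 * real s) - ?K) = (\<Sum>s=1..t div 2. 2 ^ s / (2 * real s)) - real (t div 2) * ?K"
    by (simp add: sum_subtractf)
  ultimately show ?thesis unfolding mult.assoc by linarith
qed

section \<open>Asymptotics\<close>

text \<open>Telescoping: \<open>2 ^ s / (s + 1) - 2 ^ (s - 1) / s\<close> equals
  \<open>2 ^ s / (2 * s) - 2 ^ s / (s * (s + 1))\<close>. This produces the denominator
  \<open>S + 1\<close> of the main term.\<close>

lemma sum_half_power_div:
  "(\<Sum>s=1..S. 2 ^ s / (2 * real s)) =
     2 ^ S / (real S + 1) - 1 + (\<Sum>s=1..S. 2 ^ s / (real s * (real s + 1)))"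
proof (induction S)
  case (Suc S)
  have "2 ^ Suc S / (2 * real (Suc S)) = 2 ^ Suc S / (real (Suc S) + 1) - 2 ^ S / (real S + 1) +
      2 ^ Suc S / (real (Suc S) * (real (Suc S) + 1))"
    by (simp add: divide_simps) (simp add: algebra_simps)
  then show ?case using Suc by simp
qed simp

text \<open>The growth is geometric, so the sum has the order of its last term, a factor of order
  \<open>1 / S\<close> below the main term. With the constant 8 the induction step reduces to
  \<open>3 * x ^ 2 - 3 * x - 10 \<ge> 0\<close>, which fails at \<open>x = 2\<close> and holds from
  \<open>x = 3\<close> on.\<close>

lemma sum_power_div_le:
  assumes "S \<ge> 3"
  shows "(\<Sum>s=1..S. 2 ^ s / (real s * (real s + 1))) \<le> 8 * 2 ^ S / (real S + 1)\<^sup>2"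
  using assms
proof (induction S rule: nat_induct_at_least)
  case base
  show ?case by (simp add: numeral_3_eq_3 power2_eq_square)
next
  case (Suc S)
  define x where "x = real S"
  have x: "x \<ge> 3" using Suc.hyps by (simp add: x_def)
  have "3 * x \<le> x * x" using x by (intro mult_right_mono) auto
  moreover have "8 * (x + 1)\<^sup>2 - (4 * (x + 2)\<^sup>2 + (x + 1) * (x + 2)) = 3 * (x * x) - 3 * x - 10"
    by (simp add: power2_eq_square algebra_simps)
  ultimately have "4 * (x + 2)\<^sup>2 + (x + 1) * (x + 2) \<le> 8 * (x + 1)\<^sup>2" using x by linarith
  then have "2 * (4 * (x + 2)\<^sup>2 + (x + 1) * (x + 2)) / ((x + 1)\<^sup>2 * (x + 2)\<^sup>2) \<le>
      2 * (8 * (x + 1)\<^sup>2) / ((x + 1)\<^sup>2 * (x + 2)\<^sup>2)"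
    by (intro divide_right_mono mult_left_mono) auto
  also have "2 * (8 * y\<^sup>2) / (y\<^sup>2 * z\<^sup>2) = 16 / z\<^sup>2" if "y > 0" "z > 0" for y z :: real
    using that by simp
  then have "2 * (8 * (x + 1)\<^sup>2) / ((x + 1)\<^sup>2 * (x + 2)\<^sup>2) = 16 / (x + 2)\<^sup>2" using x by simp
  also have "2 * (4 * z\<^sup>2 + y * z) / (y\<^sup>2 * z\<^sup>2) = 8 / y\<^sup>2 + 2 / (y * z)" if "y > 0" "z > 0" for y z :: real
    using that by (simp add: field_simps power2_eq_square)
  then have "2 * (4 * (x + 2)\<^sup>2 + (x + 1) * (x + 2)) / ((x + 1)\<^sup>2 * (x + 2)\<^sup>2) =
      8 / (x + 1)\<^sup>2 + 2 / ((x + 1) * (x + 2))" using x by simp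
  finally have "8 / (x + 1)\<^sup>2 + 2 / ((x + 1) * (x + 2)) \<le> 16 / (x + 2)\<^sup>2" .
  then have "2 ^ S * (8 / (x + 1)\<^sup>2 + 2 / ((x + 1) * (x + 2))) \<le> 2 ^ S * (16 / (x + 2)\<^sup>2)"
    by (intro mult_left_mono) auto
  then have "8 * 2 ^ S / (x + 1)\<^sup>2 + 2 ^ Suc S / ((x + 1) * (x + 2)) \<le> 8 * 2 ^ Suc S / (x + 2)\<^sup>2"
    by (simp add: algebra_simps)
  then have "(\<Sum>s=1..S. 2 ^ s / (real s * (real s + 1))) + 2 ^ Suc S / ((x + 1) * (x + 2)) \<le>
      8 * 2 ^ Suc S / (x + 2)\<^sup>2"
    using Suc.IH unfolding x_def by linarith
  then show ?case by (simp add: x_def add.commute)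
qed

text \<open>Since \<open>p\<close> is below \<open>q\<close>, both lie between the same two bounds.
  The errors are polynomial multiples of about \<open>2 ^ (S / 2)\<close> with
  \<open>S = t div 2\<close>, apart from one of relative size \<open>8 / (S + 1)\<close> and
  constants, so both quotients are squeezed to 1.\<close>

lemma asymp_equiv_half_power:
  fixes p q :: "nat \<Rightarrow> real"
  assumes lower: "\<And>t. (\<Sum>s=1..t div 2. 2 ^ s / (2 * real s)) - real t * (real t + 1) * 2 ^ (t div 4 + 1) \<le> p t"
    and le: "\<And>t. p t \<le> q t"
    and upper: "\<And>t. q t \<le> (\<Sum>s=1..t div 2. 2 ^ s / (2 * real s)) + (real t + 1) * 2 ^ (t div 4 + 1) + 4"
  shows "p \<sim>[at_top] (\<lambda>t. 2 ^ (t div 2) / (real (t div 2) + 1))" (is "_ \<sim>[_] ?a")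
    and "q \<sim>[at_top] (\<lambda>t. 2 ^ (t div 2) / (real (t div 2) + 1))"
proof -
  \<comment> \<open>\<open>L\<close> and \<open>U\<close> are the bounds divided by
    \<open>2 ^ S / (S + 1)\<close>, with \<open>t\<close> replaced by its largest possible value
    \<open>2 * S + 1\<close> and \<open>2 ^ (t div 4)\<close> by \<open>2 powr (S / 2)\<close>,
    which removes the rounding.\<close>
  define L where "L S = 1 - (real S + 1) / 2 ^ S - (2 * real S + 1) * (2 * real S + 2) * 2 * 2 powr (real S / 2) * (real S + 1) / 2 ^ S" for S :: nat
  define U where "U S = 1 + 8 / (real S + 1) + (2 * real S + 2) * 2 * 2 powr (real S / 2) * (real S + 1) / 2 ^ S + 4 * (real S + 1) / 2 ^ S" for S :: nat
  have limL: "L \<longlonglongrightarrow> 1" unfolding L_def by real_asymp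
  have limU: "U \<longlonglongrightarrow> 1" unfolding U_def by real_asymp
  have half: "filterlim (\<lambda>t::nat. t div 2) at_top at_top"
    unfolding filterlim_at_top
  proof
    fix Z :: nat
    show "\<forall>\<^sub>F t in at_top. Z \<le> t div 2" using eventually_ge_at_top[of "2 * Z"] by eventually_elim simp
  qed
  have limL': "(\<lambda>t. L (t div 2)) \<longlonglongrightarrow> 1" and limU': "(\<lambda>t. U (t div 2)) \<longlonglongrightarrow> 1"
    using filterlim_compose[OF limL half] filterlim_compose[OF limU half] by simp_all
  \<comment> \<open>From \<open>t = 6\<close> on, \<open>S\<close> is at least 3, where
    \<open>sum_power_div_le\<close> starts.\<close>
  have bounds: "L (t div 2) \<le> p t / ?a t" "q t / ?a t \<le> U (t div 2)" if t: "t \<ge> 6" for t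
  proof -
    define S where "S = t div 2"
    have S: "S \<ge> 3" "real t \<le> 2 * real S + 1" using t by (auto simp: S_def)
    have "(2::real) ^ (t div 4 + 1) = 2 * 2 powr real (S div 2)"
      by (simp add: S_def powr_realpow flip: div_mult2_eq)
    also have "\<dots> \<le> 2 * 2 powr (real S / 2)" by (simp add: powr_mono)
    finally have pow: "(2::real) ^ (t div 4 + 1) \<le> 2 * 2 powr (real S / 2)" .
    have a: "?a t = 2 ^ S / (real S + 1)" by (simp add: S_def)
    have pos: "?a t > 0" by simp
    have sum_lower: "?a t - 1 \<le> (\<Sum>s=1..S. 2 ^ s / (2 * real s))"
      unfolding sum_half_power_div a using sum_nonneg[of "{1..S}" "\<lambda>s. 2 ^ s / (real s * (real s + 1))"] by simp
    have sum_upper: "(\<Sum>s=1..S. 2 ^ s / (2 * real s)) \<le> ?a t + 8 * 2 ^ S / (real S + 1)\<^sup>2"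
      unfolding sum_half_power_div a using sum_power_div_le[OF S(1)] by simp
    have "real t * (real t + 1) * 2 ^ (t div 4 + 1) \<le> (2 * real S + 1) * (2 * real S + 2) * (2 * 2 powr (real S / 2))"
      using S(2) pow by (intro mult_mono) auto
    then have "?a t - 1 - (2 * real S + 1) * (2 * real S + 2) * (2 * 2 powr (real S / 2)) \<le> p t"
      using lower[of t] sum_lower unfolding S_def by linarith
    moreover have "L S * ?a t = ?a t - 1 - (2 * real S + 1) * (2 * real S + 2) * (2 * 2 powr (real S / 2))"
    proof -
      have *: "(1 - (x + 1) / P - c * d * 2 * r * (x + 1) / P) * (P / (x + 1)) = P / (x + 1) - 1 - c * d * (2 * r)"
        if "P > 0" "x \<ge> 0" for P x c d r :: real
        using that by (simp add: diff_divide_distrib left_diff_distrib)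
      show ?thesis unfolding a L_def by (rule *) auto
    qed
    ultimately have "L S * ?a t \<le> p t" by (simp only:)
    then show "L (t div 2) \<le> p t / ?a t" unfolding S_def pos_le_divide_eq[OF pos] .
    have "(real t + 1) * 2 ^ (t div 4 + 1) \<le> (2 * real S + 2) * (2 * 2 powr (real S / 2))"
      using S(2) pow by (intro mult_mono) auto
    then have "q t \<le> ?a t + 8 * 2 ^ S / (real S + 1)\<^sup>2 + (2 * real S + 2) * (2 * 2 powr (real S / 2)) + 4"
      using upper[of t] sum_upper unfolding S_def by linarith
    moreover have "U S * ?a t = ?a t + 8 * 2 ^ S / (real S + 1)\<^sup>2 + (2 * real S + 2) * (2 * 2 powr (real S / 2)) + 4"
    proof -
      have *: "(1 + 8 / y + c * 2 * r * y / P + 4 * y / P) * (P / y) =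
          P / y + 8 * P / y\<^sup>2 + c * (2 * r) + 4"
        if "P > 0" "y > 0" for P y c r :: real
        using that by (simp add: field_simps power2_eq_square)
      show ?thesis unfolding a U_def by (rule *) auto
    qed
    ultimately have "q t \<le> U S * ?a t" by (simp only:)
    then show "q t / ?a t \<le> U (t div 2)" unfolding S_def pos_divide_le_eq[OF pos] .
  qed
  have mono: "p t / ?a t \<le> q t / ?a t" for t using le by (intro divide_right_mono) auto
  have bounds': "L (t div 2) \<le> q t / ?a t" "p t / ?a t \<le> U (t div 2)" if "t \<ge> 6" for t
    using bounds[OF that] mono[of t] by linarith+
  have ev: "\<forall>\<^sub>F t in at_top. 6 \<le> (t::nat)" by (rule eventually_ge_at_top)
  have "(\<lambda>t. p t / ?a t) \<longlonglongrightarrow> 1"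
    by (rule tendsto_sandwich[OF eventually_mono[OF ev bounds(1)] eventually_mono[OF ev bounds'(2)] limL' limU'])
  then show "p \<sim>[at_top] ?a" by (intro asymp_equivI') simp
  have "(\<lambda>t. q t / ?a t) \<longlonglongrightarrow> 1"
    by (rule tendsto_sandwich[OF eventually_mono[OF ev bounds'(1)] eventually_mono[OF ev bounds(2)] limL' limU'])
  then show "q \<sim>[at_top] ?a" by (intro asymp_equivI') simp
qed

theorem theorem1p1:
  shows "((\<lambda>t::nat. real (card (inert_upto (2 * t))))
            \<sim>[at_top] (\<lambda>t. 2 ^ nat \<lfloor>real t / 2\<rfloor> / (real_of_int \<lfloor>real t / 2\<rfloor> + 1)))
       \<and> ((\<lambda>t::nat. real (card {C \<in> inert_upto (2 * t). primitive_class C}))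
            \<sim>[at_top] (\<lambda>t. real (card (inert_upto (2 * t)))))"
proof -
  let ?p = "\<lambda>t. real (card {C \<in> inert_upto (2 * t). primitive_class C})"
  let ?q = "\<lambda>t. real (card (inert_upto (2 * t)))"
  let ?a = "\<lambda>t. 2 ^ (t div 2) / (real (t div 2) + 1)"
  have le: "?p t \<le> ?q t" for t
    by (intro of_nat_mono card_mono finite_inert_upto) auto
  have lower: "(\<Sum>s=1..t div 2. 2 ^ s / (2 * real s)) - real t * (real t + 1) * 2 ^ (t div 4 + 1) \<le> ?p t" for t
    using card_primitive_sc_word_classes_ge[of t] card_mono[OF _ primitive_sc_word_classes_subset[of t]]
      finite_inert_upto[of t] by simp
  have upper: "?q t \<le> (\<Sum>s=1..t div 2. 2 ^ s / (2 * real s)) + (real t + 1) * 2 ^ (t div 4 + 1) + 4" for t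
  proof -
    have "?q t \<le> real (card (primitive_sc_word_classes t) + (t + 1) * 2 ^ (t div 4 + 1) + 4)"
      using card_inert_upto_le by (rule of_nat_mono)
    then show ?thesis using card_primitive_sc_word_classes_le[of t] by (simp add: distrib_right)
  qed
  note asymp = asymp_equiv_half_power[of ?p ?q, OF lower le upper]
  have floor: "\<lfloor>real t / 2\<rfloor> = int (t div 2)" for t
    using floor_divide_of_nat_eq[of t 2, where ?'a = real] by simp
  have "?q \<sim>[at_top] ?a" by (rule asymp(2))
  moreover have "?p \<sim>[at_top] ?q"
    using asymp(1) asymp_equiv_symI[OF asymp(2)] by (rule asymp_equiv_trans)
  ultimately show ?thesis by (simp add: floor)
qed

end
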